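(* A gain signed graph $\Upsilon=(\Gamma,\sigma,\varphi)$ (with orientation $\tau$) is hyperbalanced if and only if there is a gain switcher $\theta:V\to\mathbb{K}$ such that $\varphi^\theta(e)=0$ for every edge $e\in E$.
   Context: Let $\mathbb{K}$ be a field of characteristic $\ne2$. A graph $\Gamma=(V,E)$ has vertex set $V=\{v_1,\dots,v_n\}$ and finite edge set $E$; edges are links (two ends at distinct vertices), loops (two ends at one vertex), half edges (one end) or loose edges (no ends); parallel edges allowed. A gain signed graph $\Upsilon=(\Gamma,\sigma,\varphi)$: $\sigma:E\to\{\pm1\}$ (half edges negative, loose edges positive); with an orientation $\tau$ (signs $\tau(v,e)\in\{\pm1\}$ on edge ends, $\tau(v,e)\tau(w,e)=-\sigma(e)$ for a link or loop with ends $v,w$) each edge has gain $\varphi(e)\in\mathbb{K}$, negated on reorientation. Neutral = gain $0$. Walk gain of $W=u_0e_1\cdots e_lu_l$: $\varphi(W)=-\sum_i\varphi(e_i)\sigma(W_{0,i-1})\tau(u_{i-1},e_i)$, $\sigma(W_{0,j})=\prod_{i\le j}\sigma(e_i)$. Ultrawalks may begin with a half edge $e_0$ at $u_0$ and/or end with a half edge $e_{l+1}$ at $u_l$; their gain adds $\tau(u_0,e_0)\varphi(e_0)$ and/or $-\varphi(e_{l+1})\sigma(W_{0,l})\tau(u_l,e_{l+1})$ to $\varphi(W_{0,l})$. Circles: connected 2-regular subgraphs, sign = product of edge signs; a negative figure is a negative circle or a half edge. A sign circuit is a positive circle, a loose edge, or a handcuff (two negative figures with exactly one common vertex, or two disjoint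 negative figures plus a path joining them meeting them only at its ends). Its gain: the edge gain for a loose edge; else $\varphi(W)$ for a circuit walk (once around a positive circle; for a handcuff with figures $C_1,C_2$, connecting path $P$ of length $\ge0$: around $C_1$, along $P$, around $C_2$, back along $P$ if both circles; from half edge $C_1$ along $P$, around $C_2$, back, ending with $C_1$ if $C_1$ half edge and $C_2$ circle; from one half edge along $P$ to the other if both half edges); well defined up to sign; neutral if $0$. $\Upsilon$ is hyperbalanced if every sign circuit in $E$ is neutral. Gain switching by $\theta:V\to\mathbb{K}$: $\varphi^\theta(e)=\tau(v,e)\theta(v)+\varphi(e)+\tau(w,e)\theta(w)$ for a link or loop with ends $v,w$; $\varphi^\theta(e)=\tau(v,e)\theta(v)+\varphi(e)$ for a half edge at $v$; $\varphi^\theta(e)=\varphi(e)$ for a loose edge. *)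

theory Defs
  imports Main
begin

section \<open>Graphs with links, loops, half edges and loose edges\<close>

text \<open>
  An edge carries the list of the vertices at which its ends lie: \<open>[v, w]\<close> with \<open>v \<noteq> w\<close> is a
  link, \<open>[v, v]\<close> a loop, \<open>[v]\<close> a half edge and \<open>[]\<close> a loose edge. The order in the list only
  serves to name the ends (end \<open>0\<close>, end \<open>1\<close>), so that the two ends of a loop can be told apart;
  it has no bearing on the orientation.
\<close>

record ('v, 'e) graph =
  verts :: "'v set"
  edges :: "'e set"
  ends :: "'e \<Rightarrow> 'v list"

definition graph :: "('v, 'e, 'z) graph_scheme \<Rightarrow> bool" where
  "graph G \<longleftrightarrow> finite (verts G) \<and> finite (edges G) \<and>
     (\<forall>e\<in>edges G. set (ends G e) \<subseteq> verts G \<and> length (ends G e) \<le> 2)"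

definition ordinary_edge :: "('v, 'e, 'z) graph_scheme \<Rightarrow> 'e \<Rightarrow> bool" where
  \<comment> \<open>a link or a loop\<close>
  "ordinary_edge G e \<longleftrightarrow> e \<in> edges G \<and> length (ends G e) = 2"

definition half_edge :: "('v, 'e, 'z) graph_scheme \<Rightarrow> 'e \<Rightarrow> bool" where
  "half_edge G e \<longleftrightarrow> e \<in> edges G \<and> length (ends G e) = 1"

definition loose_edge :: "('v, 'e, 'z) graph_scheme \<Rightarrow> 'e \<Rightarrow> bool" where
  "loose_edge G e \<longleftrightarrow> e \<in> edges G \<and> ends G e = []"

definition verts_of :: "('v, 'e, 'z) graph_scheme \<Rightarrow> 'e set \<Rightarrow> 'v set" where
  "verts_of G F = (\<Union>e\<in>F. set (ends G e))"

definition valency :: "('v, 'e, 'z) graph_scheme \<Rightarrow> 'e set \<Rightarrow> 'v \<Rightarrow> nat" where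
  \<comment> \<open>counts edge ends, hence a loop twice\<close>
  "valency G F v = card {(e, i). e \<in> F \<and> i < length (ends G e) \<and> ends G e ! i = v}"


section \<open>Walks and circles\<close>

text \<open>
  A step \<open>(e, i)\<close> traverses the link or loop \<open>e\<close>, leaving through its end \<open>i\<close> and arriving at its
  end \<open>1 - i\<close>. A walk \<open>u\<^sub>0 e\<^sub>1 u\<^sub>1 \<dots> e\<^sub>l u\<^sub>l\<close> is its initial vertex together with its steps.
\<close>

type_synonym 'e step = "'e \<times> nat"

definition step_tail :: "('v, 'e, 'z) graph_scheme \<Rightarrow> 'e step \<Rightarrow> 'v" where
  "step_tail G s = ends G (fst s) ! snd s"

definition step_head :: "('v, 'e, 'z) graph_scheme \<Rightarrow> 'e step \<Rightarrow> 'v" where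
  "step_head G s = ends G (fst s) ! (1 - snd s)"

fun walk :: "('v, 'e, 'z) graph_scheme \<Rightarrow> 'v \<Rightarrow> 'e step list \<Rightarrow> 'v \<Rightarrow> bool" where
  "walk G u [] v \<longleftrightarrow> u \<in> verts G \<and> u = v"
| "walk G u (s # W) v \<longleftrightarrow> ordinary_edge G (fst s) \<and> snd s < 2 \<and> step_tail G s = u \<and>
     walk G (step_head G s) W v"

definition walk_edges :: "'e step list \<Rightarrow> 'e set" where
  "walk_edges W = fst ` set W"

definition walk_verts :: "('v, 'e, 'z) graph_scheme \<Rightarrow> 'v \<Rightarrow> 'e step list \<Rightarrow> 'v list" where
  "walk_verts G u W = u # map (step_head G) W"

definition rev_walk :: "'e step list \<Rightarrow> 'e step list" where
  "rev_walk W = rev (map (\<lambda>(e, i). (e, 1 - i)) W)"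

definition path :: "('v, 'e, 'z) graph_scheme \<Rightarrow> 'v \<Rightarrow> 'e step list \<Rightarrow> 'v \<Rightarrow> bool" where
  "path G u P v \<longleftrightarrow> walk G u P v \<and> distinct (walk_verts G u P)"

text \<open>
  Circles are given by their edge sets. They consist of links and loops only; half edges have to
  be excluded explicitly, since a path with a half edge attached at either end also has two
  edge ends at each of its vertices.
\<close>

definition circle :: "('v, 'e, 'z) graph_scheme \<Rightarrow> 'e set \<Rightarrow> bool" where
  "circle G C \<longleftrightarrow> C \<noteq> {} \<and> (\<forall>e\<in>C. ordinary_edge G e) \<and>
     (\<forall>v\<in>verts_of G C. valency G C v = 2) \<and>
     (\<forall>u\<in>verts_of G C. \<forall>v\<in>verts_of G C. \<exists>W. walk G u W v \<and> walk_edges W \<subseteq> C)"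

definition circle_walk :: "('v, 'e, 'z) graph_scheme \<Rightarrow> 'e set \<Rightarrow> 'v \<Rightarrow> 'e step list \<Rightarrow> bool" where
  \<comment> \<open>once around the circle \<open>C\<close>, starting and ending at \<open>u\<close>, in either direction\<close>
  "circle_walk G C u W \<longleftrightarrow> walk G u W u \<and> distinct (map fst W) \<and> walk_edges W = C"


section \<open>Gain signed graphs\<close>

text \<open>
  \<open>orient \<Upsilon> e i\<close> is the orientation sign at the end \<open>i\<close> of \<open>e\<close>. As the gain of an edge changes sign
  when the edge is reoriented, gains are functions on edges only with respect to an orientation;
  \<open>gain \<Upsilon> e\<close> is the gain of \<open>e\<close> in the orientation \<open>orient \<Upsilon>\<close>.
\<close>

record ('v, 'e) oriented_signed_graph = "('v, 'e) graph" +
  esign :: "'e \<Rightarrow> int"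
  orient :: "'e \<Rightarrow> nat \<Rightarrow> int"

record ('v, 'e, 'k) gain_signed_graph = "('v, 'e) oriented_signed_graph" +
  gain :: "'e \<Rightarrow> 'k"

definition oriented_signed_graph :: "('v, 'e, 'z) oriented_signed_graph_scheme \<Rightarrow> bool" where
  "oriented_signed_graph S \<longleftrightarrow> graph S \<and>
     (\<forall>e\<in>edges S. esign S e \<in> {1, -1}) \<and>
     (\<forall>e. half_edge S e \<longrightarrow> esign S e = -1) \<and>
     (\<forall>e. loose_edge S e \<longrightarrow> esign S e = 1) \<and>
     (\<forall>e\<in>edges S. \<forall>i<length (ends S e). orient S e i \<in> {1, -1}) \<and>
     (\<forall>e. ordinary_edge S e \<longrightarrow> orient S e 0 * orient S e 1 = - esign S e)"

abbreviation gain_signed_graph :: "('v, 'e, 'k) gain_signed_graph \<Rightarrow> bool" where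
  "gain_signed_graph \<Upsilon> \<equiv> oriented_signed_graph \<Upsilon>"

definition walk_sign :: "('v, 'e, 'z) oriented_signed_graph_scheme \<Rightarrow> 'e step list \<Rightarrow> int" where
  "walk_sign S W = (\<Prod>s\<leftarrow>W. esign S (fst s))"

definition walk_gain :: "('v, 'e, 'k::field) gain_signed_graph \<Rightarrow> 'e step list \<Rightarrow> 'k" where
  "walk_gain \<Upsilon> W = - (\<Sum>j<length W. gain \<Upsilon> (fst (W ! j)) * of_int (walk_sign \<Upsilon> (take j W)) *
     of_int (orient \<Upsilon> (fst (W ! j)) (snd (W ! j))))"

definition ultrawalk_gain ::
  "('v, 'e, 'k::field) gain_signed_graph \<Rightarrow> 'e option \<Rightarrow> 'e step list \<Rightarrow> 'e option \<Rightarrow> 'k" where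
  \<comment> \<open>a walk possibly preceded by a half edge and possibly followed by a half edge\<close>
  "ultrawalk_gain \<Upsilon> h W h' =
     (case h of None \<Rightarrow> 0 | Some e \<Rightarrow> of_int (orient \<Upsilon> e 0) * gain \<Upsilon> e) +
     walk_gain \<Upsilon> W +
     (case h' of None \<Rightarrow> 0 | Some e \<Rightarrow> - (gain \<Upsilon> e * of_int (walk_sign \<Upsilon> W) * of_int (orient \<Upsilon> e 0)))"


section \<open>Sign circuits\<close>

definition positive_circle :: "('v, 'e, 'z) oriented_signed_graph_scheme \<Rightarrow> 'e set \<Rightarrow> bool" where
  "positive_circle S C \<longleftrightarrow> circle S C \<and> (\<Prod>e\<in>C. esign S e) = 1"

definition negative_circle :: "('v, 'e, 'z) oriented_signed_graph_scheme \<Rightarrow> 'e set \<Rightarrow> bool" where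
  "negative_circle S C \<longleftrightarrow> circle S C \<and> (\<Prod>e\<in>C. esign S e) = -1"

definition negative_figure :: "('v, 'e, 'z) oriented_signed_graph_scheme \<Rightarrow> 'e set \<Rightarrow> bool" where
  "negative_figure S C \<longleftrightarrow> negative_circle S C \<or> (\<exists>e. half_edge S e \<and> C = {e})"

text \<open>
  A handcuff formed by two negative figures \<open>C\<^sub>1\<close> and \<open>C\<^sub>2\<close> and the connecting path \<open>P\<close> from \<open>u\<close>
  to \<open>v\<close>, which has length \<open>0\<close> if the figures have a vertex in common.
\<close>

definition handcuff ::
  "('v, 'e, 'z) oriented_signed_graph_scheme \<Rightarrow> 'e set \<Rightarrow> 'v \<Rightarrow> 'e step list \<Rightarrow> 'v \<Rightarrow> 'e set \<Rightarrow> bool"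
where
  "handcuff S C\<^sub>1 u P v C\<^sub>2 \<longleftrightarrow>
     negative_figure S C\<^sub>1 \<and> negative_figure S C\<^sub>2 \<and> C\<^sub>1 \<noteq> C\<^sub>2 \<and>
     path S u P v \<and> u \<in> verts_of S C\<^sub>1 \<and> v \<in> verts_of S C\<^sub>2 \<and>
     (verts_of S C\<^sub>1 \<inter> verts_of S C\<^sub>2 = {u} \<and> P = [] \<or>
      verts_of S C\<^sub>1 \<inter> verts_of S C\<^sub>2 = {} \<and>
      set (walk_verts S u P) \<inter> (verts_of S C\<^sub>1 \<union> verts_of S C\<^sub>2) = {u, v})"

definition sign_circuit :: "('v, 'e, 'z) oriented_signed_graph_scheme \<Rightarrow> 'e set \<Rightarrow> bool" where
  "sign_circuit S F \<longleftrightarrow>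
     positive_circle S F \<or>
     (\<exists>e. loose_edge S e \<and> F = {e}) \<or>
     (\<exists>C\<^sub>1 u P v C\<^sub>2. handcuff S C\<^sub>1 u P v C\<^sub>2 \<and> F = C\<^sub>1 \<union> walk_edges P \<union> C\<^sub>2)"

text \<open>
  \<open>circuit_walk S F h W h'\<close>: the ultrawalk \<open>h W h'\<close> is a circuit walk of the sign circuit \<open>F\<close>.
  As the two figures of a handcuff may be interchanged, the third rule also covers handcuffs
  whose second figure is the half edge.
\<close>

inductive circuit_walk ::
  "('v, 'e, 'z) oriented_signed_graph_scheme \<Rightarrow> 'e set \<Rightarrow> 'e option \<Rightarrow> 'e step list \<Rightarrow> 'e option \<Rightarrow> bool"
  for S
where
  positive_circle:
    "\<lbrakk>positive_circle S C; circle_walk S C u W\<rbrakk> \<Longrightarrow> circuit_walk S C None W None"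
| circle_circle:
    "\<lbrakk>handcuff S C\<^sub>1 u P v C\<^sub>2; negative_circle S C\<^sub>1; negative_circle S C\<^sub>2;
      circle_walk S C\<^sub>1 u W\<^sub>1; circle_walk S C\<^sub>2 v W\<^sub>2\<rbrakk> \<Longrightarrow>
     circuit_walk S (C\<^sub>1 \<union> walk_edges P \<union> C\<^sub>2) None (W\<^sub>1 @ P @ W\<^sub>2 @ rev_walk P) None"
| half_circle:
    "\<lbrakk>handcuff S {h} u P v C; half_edge S h; negative_circle S C; circle_walk S C v W\<rbrakk> \<Longrightarrow>
     circuit_walk S ({h} \<union> walk_edges P \<union> C) (Some h) (P @ W @ rev_walk P) (Some h)"
| half_half:
    "\<lbrakk>handcuff S {h} u P v {h'}; half_edge S h; half_edge S h'\<rbrakk> \<Longrightarrow>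
     circuit_walk S ({h} \<union> walk_edges P \<union> {h'}) (Some h) P (Some h')"

text \<open>
  The gain of a sign circuit is determined up to sign only, hence a relation. Every sign circuit
  has a circuit walk unless it is a loose edge.
\<close>

inductive circuit_gain :: "('v, 'e, 'k::field) gain_signed_graph \<Rightarrow> 'e set \<Rightarrow> 'k \<Rightarrow> bool"
  for \<Upsilon>
where
  loose: "loose_edge \<Upsilon> e \<Longrightarrow> circuit_gain \<Upsilon> {e} (gain \<Upsilon> e)"
| walk: "circuit_walk \<Upsilon> F h W h' \<Longrightarrow> circuit_gain \<Upsilon> F (ultrawalk_gain \<Upsilon> h W h')"

definition neutral_circuit :: "('v, 'e, 'k::field) gain_signed_graph \<Rightarrow> 'e set \<Rightarrow> bool" where
  "neutral_circuit \<Upsilon> F \<longleftrightarrow> (\<forall>g. circuit_gain \<Upsilon> F g \<longrightarrow> g = 0)"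

definition hyperbalanced :: "('v, 'e, 'k::field) gain_signed_graph \<Rightarrow> bool" where
  "hyperbalanced \<Upsilon> \<longleftrightarrow> (\<forall>F\<subseteq>edges \<Upsilon>. sign_circuit \<Upsilon> F \<longrightarrow> neutral_circuit \<Upsilon> F)"


section \<open>Gain switching\<close>

definition switched_gain ::
  "('v, 'e, 'k::field) gain_signed_graph \<Rightarrow> ('v \<Rightarrow> 'k) \<Rightarrow> 'e \<Rightarrow> 'k" where
  "switched_gain \<Upsilon> \<theta> e =
     (case ends \<Upsilon> e of
        [v, w] \<Rightarrow> of_int (orient \<Upsilon> e 0) * \<theta> v + gain \<Upsilon> e + of_int (orient \<Upsilon> e 1) * \<theta> w
      | [v] \<Rightarrow> of_int (orient \<Upsilon> e 0) * \<theta> v + gain \<Upsilon> e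
      | _ \<Rightarrow> gain \<Upsilon> e)"

end

(*
  If the switched gains vanish on a set F of edges, the gain of a walk W in F from u to v is
  \<theta> u - \<sigma>(W) \<theta> v. This makes every sign circuit neutral. Conversely, \<theta> is built one edge e at a
  time. If an end v of e is linked in F to no negative figure, the signs of the F-walks to v are
  well defined, and adding a multiple of them to \<theta> changes nothing on F but kills the
  residual gain of e (or else e closes a positive circle, whose neutrality forces the residual to
  vanish). If both ends of e are linked to negative figures, some sign circuit contains e and lies
  otherwise in F, and again the residual vanishes by neutrality of this circuit.
*)

theory Submission
  imports Defs
begin

section \<open>Walks, paths and cycles\<close>

text \<open>\<open>sign_circuit\<close> admits only genuine circles and handcuffs, whereas being
  linked in F yields arbitrary walks; most of the graph theory below cuts such walks down until the
  definition applies. The critical case is an edge e that closes a negative circle meeting a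
  negative figure C in several vertices, so that the two form no handcuff. Then C is itself a
  circle. Its two arcs between the first and the last common vertex, along the path that completes
  e, have opposite signs, and one of the two reroutings closes a positive circle with e.

  All kinds of handcuffs are reduced to one linear equation between the weights of the two figures,
  at the price of counting a half edge twice. A negative figure at u controls only 2 \<theta> u, so
  the characteristic enters when 2 is cancelled, and once more when a sign is recovered from its
  image in the field.\<close>

lemma walk_edges_simps [simp]:
  "walk_edges [] = {}"
  "walk_edges (s # W) = insert (fst s) (walk_edges W)"
  "walk_edges (A @ B) = walk_edges A \<union> walk_edges B"
  "walk_edges (rev_walk W) = walk_edges W"
  by (auto simp: walk_edges_def rev_walk_def image_image split_def)

lemma ordinary_ends_in_verts:
  assumes "graph G" "ordinary_edge G e" "i < 2"
  shows "ends G e ! i \<in> verts G"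
  using assms unfolding graph_def ordinary_edge_def by (metis nth_mem subsetD)

lemma step_ends_in_verts:
  assumes "graph G" "ordinary_edge G (fst s)" "snd s < 2"
  shows "step_tail G s \<in> verts G" "step_head G s \<in> verts G"
  using assms by (auto simp: step_tail_def step_head_def intro: ordinary_ends_in_verts)

lemma set_ends_step:
  assumes "ordinary_edge G (fst s)" "snd s < 2"
  shows "set (ends G (fst s)) = {step_tail G s, step_head G s}"
proof -
  from assms obtain v w where "ends G (fst s) = [v, w]"
    by (auto simp: ordinary_edge_def length_Suc_conv numeral_2_eq_2)
  moreover from assms have "snd s = 0 \<or> snd s = 1" by auto
  ultimately show ?thesis by (auto simp: step_tail_def step_head_def)
qed

lemma walk_verts_in:
  assumes "graph G" "walk G u W v"
  shows "u \<in> verts G" "v \<in> verts G"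
proof -
  have "u \<in> verts G \<and> v \<in> verts G"
    using assms(2) by (induction W arbitrary: u) (auto simp: step_ends_in_verts assms(1))
  then show "u \<in> verts G" "v \<in> verts G" by auto
qed

lemma walk_append:
  assumes "graph G"
  shows "walk G u (A @ B) v \<longleftrightarrow> (\<exists>x. walk G u A x \<and> walk G x B v)"
  by (induction A arbitrary: u) (auto dest: walk_verts_in[OF assms])

lemma walk_appendI:
  assumes "graph G" "walk G u A x" "walk G x B v"
  shows "walk G u (A @ B) v"
  using assms walk_append by metis

lemma walk_ordinary:
  assumes "walk G u W v" "s \<in> set W"
  shows "ordinary_edge G (fst s)" "snd s < 2"
  using assms by (induction W arbitrary: u) auto

lemma walk_tails_heads:
  assumes "walk G u W v"
  shows "map (step_tail G) W @ [v] = u # map (step_head G) W"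
  using assms by (induction W arbitrary: u) auto

lemma walk_verts_snoc:
  assumes "walk G u W v"
  shows "walk_verts G u W = map (step_tail G) W @ [v]"
  using walk_tails_heads[OF assms] by (simp add: walk_verts_def)

lemma walk_verts_simps [simp]:
  "walk_verts G u [] = [u]"
  "walk_verts G u (s # W) = u # walk_verts G (step_head G s) W"
  "walk_verts G u (A @ B) = walk_verts G u A @ map (step_head G) B"
  by (auto simp: walk_verts_def)

lemma start_in_walk_verts [simp]: "u \<in> set (walk_verts G u W)"
  by (simp add: walk_verts_def)

lemma end_in_walk_verts: "walk G u W v \<Longrightarrow> v \<in> set (walk_verts G u W)"
  by (simp add: walk_verts_snoc)

lemma rev_walk_simps [simp]:
  "rev_walk [] = []"
  "rev_walk (s # W) = rev_walk W @ [(fst s, 1 - snd s)]"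
  by (simp_all add: rev_walk_def split_def)

lemma step_flip [simp]:
  "step_tail G (e, Suc 0 - i) = step_head G (e, i)"
  "i < 2 \<Longrightarrow> step_head G (e, Suc 0 - i) = step_tail G (e, i)"
  by (auto simp: step_tail_def step_head_def less_2_cases_iff)

lemma walk_rev:
  assumes "graph G" "walk G u W v"
  shows "walk G v (rev_walk W) u"
  using assms(2)
proof (induction W arbitrary: u)
  case (Cons s W)
  then have "walk G v (rev_walk W) (step_head G s)" by simp
  moreover have "walk G (step_head G s) [(fst s, 1 - snd s)] u"
    using Cons.prems by (cases s) (auto simp: step_ends_in_verts[OF assms(1)])
  ultimately show ?case using walk_appendI[OF assms(1)] unfolding rev_walk_simps by blast
qed auto

lemma heads_rev_walk:
  assumes "walk G u W v"
  shows "map (step_head G) (rev_walk W) = rev (map (step_tail G) W)"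
  using assms by (induction W arbitrary: u) auto

lemma walk_verts_rev:
  assumes "walk G u W v"
  shows "walk_verts G v (rev_walk W) = rev (walk_verts G u W)"
  using heads_rev_walk[OF assms] by (simp add: walk_verts_snoc[OF assms]) (simp add: walk_verts_def)

section \<open>Cutting walks at prescribed vertices\<close>

lemma walk_split_at:
  assumes "graph G" "walk G u W v" "x \<in> set (walk_verts G u W)"
  obtains A B where "W = A @ B" "walk G u A x" "walk G x B v"
proof -
  have "\<exists>A B. W = A @ B \<and> walk G u A x \<and> walk G x B v"
    using assms(2,3)
  proof (induction W arbitrary: u)
    case (Cons s W)
    show ?case
    proof (cases "x = u")
      case True
      then show ?thesis
        using Cons.prems walk_verts_in[OF assms(1)]
        by (intro exI[of _ "[]"] exI[of _ "s # W"]) (auto simp: step_ends_in_verts[OF assms(1)])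
    next
      case False
      then obtain A B where "W = A @ B" "walk G (step_head G s) A x" "walk G x B v"
        using Cons.IH[of "step_head G s"] Cons.prems by auto
      then show ?thesis
        using Cons.prems by (intro exI[of _ "s # A"] exI[of _ B]) auto
    qed
  qed auto
  then show thesis using that by blast
qed

lemma walk_first_in:
  assumes "graph G" "walk G u W v" "set (walk_verts G u W) \<inter> X \<noteq> {}"
  obtains A B x where "W = A @ B" "walk G u A x" "walk G x B v" "set (walk_verts G u A) \<inter> X = {x}"
proof -
  have "\<exists>A B x. W = A @ B \<and> walk G u A x \<and> walk G x B v \<and> set (walk_verts G u A) \<inter> X = {x}"
    using assms(2,3)
  proof (induction W arbitrary: u)
    case (Cons s W)
    show ?case
    proof (cases "u \<in> X")
      case True
      then show ?thesis
        using Cons.prems walk_verts_in[OF assms(1)]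
        by (intro exI[of _ "[]"] exI[of _ "s # W"] exI[of _ u])
          (auto simp: step_ends_in_verts[OF assms(1)])
    next
      case False
      then obtain A B x where "W = A @ B" "walk G (step_head G s) A x" "walk G x B v"
        "set (walk_verts G (step_head G s) A) \<inter> X = {x}"
        using Cons.IH[of "step_head G s"] Cons.prems by auto
      moreover from this have "set (walk_verts G u (s # A)) \<inter> X = {x}" "walk G u (s # A) x"
        using Cons.prems False by (simp_all add: Int_insert_left)
      ultimately show ?thesis by (metis append_Cons)
    qed
  qed auto
  then show thesis using that by blast
qed

lemma walk_last_in:
  assumes "graph G" "walk G u W v" "set (walk_verts G u W) \<inter> X \<noteq> {}"
  obtains A B x where "W = A @ B" "walk G u A x" "walk G x B v" "set (walk_verts G x B) \<inter> X = {x}"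
proof -
  have "\<exists>A B x. W = A @ B \<and> walk G u A x \<and> walk G x B v \<and> set (walk_verts G x B) \<inter> X = {x}"
    using assms(2,3)
  proof (induction W arbitrary: u)
    case (Cons s W)
    show ?case
    proof (cases "set (walk_verts G (step_head G s) W) \<inter> X = {}")
      case True
      then have "set (walk_verts G u (s # W)) \<inter> X = {u}" using Cons.prems by auto
      then show ?thesis
        using Cons.prems walk_verts_in[OF assms(1)]
        by (intro exI[of _ "[]"] exI[of _ "s # W"] exI[of _ u])
          (auto simp: step_ends_in_verts[OF assms(1)])
    next
      case False
      then obtain A B x where "W = A @ B" "walk G (step_head G s) A x" "walk G x B v"
        "set (walk_verts G x B) \<inter> X = {x}"
        using Cons.IH[of "step_head G s"] Cons.prems by auto
      moreover from this have "walk G u (s # A) x"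
        using Cons.prems by simp
      ultimately show ?thesis by (metis append_Cons)
    qed
  qed auto
  then show thesis using that by blast
qed

text \<open>A closed walk always returns to its initial vertex, so repetitions are sought among the
  heads only. The repeated vertex is then reached after at least one step, whence
  \<open>A \<noteq> []\<close>: both B and the remainder \<open>A @ D\<close> are nonempty, so both
  are shorter than W, as an induction on length needs.\<close>

lemma walk_closed_decomp:
  assumes "graph G" "walk G u W v" "\<not> distinct (map (step_head G) W)"
  obtains A B D x where "W = A @ B @ D" "walk G u A x" "walk G x B x" "walk G x D v"
    "A \<noteq> []" "B \<noteq> []"
proof -
  obtain xs y ys zs where "map (step_head G) W = xs @ [y] @ ys @ [y] @ zs"
    using not_distinct_decomp[OF assms(3)] by blast
  then obtain A' s B' s' D where W: "W = A' @ s # B' @ s' # D"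
    and "step_head G s = y" "step_head G s' = y"
    by (auto simp: map_eq_append_conv map_eq_Cons_conv Cons_eq_map_conv append_eq_map_conv)
  moreover have "W = (A' @ [s]) @ (B' @ [s']) @ D" using W by simp
  ultimately show thesis
    using assms(2) that[of "A' @ [s]" "B' @ [s']" D y]
    by (force simp: walk_append[OF assms(1)] dest: step_ends_in_verts[OF assms(1)])
qed

text \<open>A shortest walk from X to Y within the given edges has these properties, since any
  defect allows a piece to be cut off or cut out. Meeting each set in a single vertex is what
  \<open>handcuff\<close> demands of a connecting path of disjoint figures.\<close>

lemma path_between_sets:
  assumes "graph G" "walk G a W b" "a \<in> X" "b \<in> Y"
  obtains u P v where "path G u P v" "walk_edges P \<subseteq> walk_edges W"
    "set (walk_verts G u P) \<inter> X = {u}" "set (walk_verts G u P) \<inter> Y = {v}"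
proof -
  note ap = walk_append[OF assms(1)]
  have "\<exists>u P v. path G u P v \<and> walk_edges P \<subseteq> walk_edges W \<and>
    set (walk_verts G u P) \<inter> X = {u} \<and> set (walk_verts G u P) \<inter> Y = {v}"
    using assms(2-)
  proof (induction "length W" arbitrary: a W b rule: less_induct)
    case less
    have shorter: ?case if "length W' < length W" "walk G a' W' b'" "a' \<in> X" "b' \<in> Y"
      "walk_edges W' \<subseteq> walk_edges W" for W' :: "'b step list" and a' b'
    proof -
      note IH = less.hyps[OF that(1-4)] and sub = that(5)
      obtain u P v where "path G u P v" "walk_edges P \<subseteq> walk_edges W'"
        "set (walk_verts G u P) \<inter> X = {u}" "set (walk_verts G u P) \<inter> Y = {v}"
        using IH by blast
      then show ?thesis using sub by blast
    qed
    show ?case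
    proof (cases "path G a W b \<and> set (walk_verts G a W) \<inter> X = {a} \<and> set (walk_verts G a W) \<inter> Y = {b}")
      case True
      then show ?thesis by blast
    next
      case False
      \<comment> \<open>The heads omit the initial vertex, so a return to it is a case separate from
        a repetition among the later vertices.\<close>
      then consider (X) x where "x \<in> set (walk_verts G a W)" "x \<in> X" "x \<noteq> a"
        | (Y) x where "x \<in> set (walk_verts G a W)" "x \<in> Y" "x \<noteq> b"
        | (start) "a \<in> set (map (step_head G) W)"
        | (inner) "\<not> distinct (map (step_head G) W)"
        using less.prems end_in_walk_verts[of G a W b]
        by (auto simp: path_def walk_verts_def)
      then show ?thesis
      proof cases
        case X
        obtain A B where W: "W = A @ B" "walk G a A x" "walk G x B b"
          using walk_split_at[OF assms(1) less.prems(1) X(1)] .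
        then have "A \<noteq> []" using X(3) by auto
        then show ?thesis using shorter[OF _ W(3) X(2) less.prems(3)] W(1) by simp
      next
        case Y
        obtain A B where W: "W = A @ B" "walk G a A x" "walk G x B b"
          using walk_split_at[OF assms(1) less.prems(1) Y(1)] .
        then have "B \<noteq> []" using Y(3) by auto
        then show ?thesis using shorter[OF _ W(2) less.prems(2) Y(2)] W(1) by simp
      next
        case start
        then obtain A s B where W: "W = A @ s # B" "step_head G s = a" by (auto dest: split_list)
        then have "walk G a B b" using less.prems(1) by (auto simp: ap)
        from shorter[OF _ this less.prems(2,3)] W(1) show ?thesis by auto
      next
        case inner
        obtain A B D x where W: "W = A @ B @ D" "walk G a A x" "walk G x B x" "walk G x D b" "B \<noteq> []"
          using walk_closed_decomp[OF assms(1) less.prems(1) inner] .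
        from shorter[OF _ walk_appendI[OF assms(1) W(2,4)] less.prems(2,3)] W(1,5)
        show ?thesis by auto
      qed
    qed
  qed
  then show thesis using that by blast
qed

section \<open>Paths: existence, concatenation, reversal, distinct edges\<close>

lemma walk_to_path:
  assumes "graph G" "walk G u W v"
  obtains P where "path G u P v" "walk_edges P \<subseteq> walk_edges W"
proof -
  obtain a P b where P: "path G a P b" "walk_edges P \<subseteq> walk_edges W"
    "set (walk_verts G a P) \<inter> {u} = {a}" "set (walk_verts G a P) \<inter> {v} = {b}"
    using path_between_sets[OF assms, of "{u}" "{v}"] by blast
  from P(3,4) have "a = u" "b = v" by auto
  with P show thesis using that by blast
qed

lemma path_append:
  assumes "graph G" "path G u A x" "path G x B v"
    and "set (walk_verts G u A) \<inter> set (walk_verts G x B) \<subseteq> {x}"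
  shows "path G u (A @ B) v"
proof -
  have "distinct (walk_verts G x B)" "distinct (walk_verts G u A)" using assms by (auto simp: path_def)
  then have "x \<notin> set (map (step_head G) B)" "distinct (map (step_head G) B)"
    by (auto simp: walk_verts_def)
  moreover have "set (map (step_head G) B) \<subseteq> set (walk_verts G x B)" by (auto simp: walk_verts_def)
  ultimately have "distinct (walk_verts G u (A @ B))"
    using assms(4) \<open>distinct (walk_verts G u A)\<close> unfolding walk_verts_simps distinct_append by blast
  then show ?thesis using assms(2,3) walk_appendI[OF assms(1)] unfolding path_def by blast
qed

lemma path_rev:
  assumes "graph G" "path G u P v"
  shows "path G v (rev_walk P) u"
  using assms walk_verts_rev[of G u P v] walk_rev[of G u P v] by (simp add: path_def)

lemma path_closed_Nil:
  assumes "path G u P u"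
  shows "P = []"
proof (cases P)
  case (Cons s Q)
  then show ?thesis
    using assms end_in_walk_verts[of G "step_head G s" Q u] by (auto simp: path_def)
qed

lemma step_verts_in_walk_verts:
  assumes "walk G u W v" "s \<in> set W"
  shows "step_tail G s \<in> set (walk_verts G u W)" "step_head G s \<in> set (walk_verts G u W)"
proof -
  show "step_tail G s \<in> set (walk_verts G u W)" using assms by (simp add: walk_verts_snoc)
  show "step_head G s \<in> set (walk_verts G u W)" using assms(2) by (simp add: walk_verts_def)
qed

text \<open>A second use of an edge would revisit the vertex from which the first use
  started.\<close>

lemma path_distinct_edges:
  assumes "path G u P v"
  shows "distinct (map fst P)"
  using assms
proof (induction P arbitrary: u)
  case (Cons s P)
  have P: "path G (step_head G s) P v" "u \<notin> set (walk_verts G (step_head G s) P)"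
    using Cons.prems by (auto simp: path_def)
  have "fst s \<notin> fst ` set P"
  proof
    assume "fst s \<in> fst ` set P"
    then obtain s' where s': "s' \<in> set P" "fst s' = fst s" by force
    have w: "walk G (step_head G s) P v" using P(1) by (simp add: path_def)
    have "set (ends G (fst s')) \<subseteq> set (walk_verts G (step_head G s) P)"
      using set_ends_step[OF walk_ordinary[OF w s'(1)]] step_verts_in_walk_verts[OF w s'(1)] by simp
    moreover have "u \<in> set (ends G (fst s))"
      using Cons.prems set_ends_step[of G s] by (auto simp: path_def)
    ultimately show False using P(2) s'(2) by auto
  qed
  then show ?case using Cons.IH[OF P(1)] by simp
qed simp

text \<open>A based and directed form of \<open>circle\<close>, on which gains can be computed.
  Distinct heads alone would admit the walk that goes along a link and back again, hence the second
  distinctness condition.\<close>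

definition cycle :: "('v, 'e, 'z) graph_scheme \<Rightarrow> 'v \<Rightarrow> 'e step list \<Rightarrow> bool" where
  "cycle G u W \<longleftrightarrow> walk G u W u \<and> W \<noteq> [] \<and> distinct (map (step_head G) W) \<and> distinct (map fst W)"

text \<open>The set of steps determines the edge set and, through it, the sign. The gain is not
  preserved in general: for a negative cycle it depends on the base point.\<close>

lemma cycle_rotate:
  assumes "graph G" "cycle G u W" "x \<in> set (map (step_head G) W)"
  obtains W' where "cycle G x W'" "set W' = set W"
proof -
  obtain A s B where W: "W = A @ s # B" "step_head G s = x"
    using assms(3) by (auto dest: split_list)
  let ?W = "B @ A @ [s]"
  have "distinct (map (step_head G) ?W)" "distinct (map fst ?W)"
    using assms(2) unfolding cycle_def W by auto
  moreover have "walk G x ?W x"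
    using assms(2) W step_ends_in_verts[OF assms(1)]
    unfolding cycle_def by (force simp: walk_append[OF assms(1)])
  ultimately have "cycle G x ?W" using assms(2) unfolding cycle_def by auto
  then show thesis using that[of ?W] W by auto
qed

lemma verts_of_cycle:
  assumes "cycle G u W"
  shows "verts_of G (walk_edges W) = set (walk_verts G u W)"
    "verts_of G (walk_edges W) = set (map (step_head G) W)"
proof -
  have w: "walk G u W u" using assms by (simp add: cycle_def)
  have "\<And>s. s \<in> set W \<Longrightarrow> set (ends G (fst s)) = {step_tail G s, step_head G s}"
    using set_ends_step walk_ordinary[OF w] by metis
  then have *: "verts_of G (walk_edges W) = step_tail G ` set W \<union> step_head G ` set W"
    unfolding verts_of_def walk_edges_def by auto
  have "u \<in> set (map (step_head G) W)"
    using walk_tails_heads[OF w] assms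
    by (metis cycle_def last_ConsR last_in_set last_snoc map_is_Nil_conv)
  moreover have "insert u (set (map (step_tail G) W)) = insert u (set (map (step_head G) W))"
    using arg_cong[OF walk_tails_heads[OF w], of set] by simp
  ultimately show "verts_of G (walk_edges W) = set (walk_verts G u W)"
    "verts_of G (walk_edges W) = set (map (step_head G) W)"
    unfolding * walk_verts_def by auto
qed

lemma cycle_valency:
  assumes "cycle G u W" "v \<in> verts_of G (walk_edges W)"
  shows "valency G (walk_edges W) v = 2"
proof -
  have w: "walk G u W u" and d: "distinct (map (step_head G) W)" "distinct (map fst W)"
    using assms by (auto simp: cycle_def)
  obtain T where T: "map (step_tail G) W = u # T" "T @ [u] = map (step_head G) W"
    using walk_tails_heads[OF w] assms(1) by (cases W) (auto simp: cycle_def)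
  then have dt: "distinct (map (step_tail G) W)"
    and tails: "set (map (step_tail G) W) = set (map (step_head G) W)"
    using d(1) by (auto simp flip: T(2))
  obtain s where s: "s \<in> set W" "step_head G s = v"
    using assms verts_of_cycle(2) by fastforce
  then obtain t where t: "t \<in> set W" "step_tail G t = v"
    using tails by (metis (no_types, lifting) imageE image_eqI set_map)
  have ord: "length (ends G (fst s)) = 2" "snd s < 2" if "s \<in> set W" for s
    using walk_ordinary[OF w that] by (auto simp: ordinary_edge_def)
  have edge_inj: "s = s'" if "s \<in> set W" "s' \<in> set W" "fst s = fst s'" for s s'
    using d(2) that by (auto simp: distinct_map inj_on_def)
  let ?E = "{(e, i). e \<in> walk_edges W \<and> i < length (ends G e) \<and> ends G e ! i = v}"
  \<comment> \<open>A step is a pair of an edge and an end number, so it also names the edge end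
    through which it leaves. The vertex v is the head of one step s and the tail of one step t; its
    edge ends are the far end of s and t itself.\<close>
  have "(e, i) \<in> ?E \<longleftrightarrow> (e, i) = t \<or> (e, i) = (fst s, 1 - snd s)" for e i
  proof
    assume ei: "(e, i) \<in> ?E"
    then obtain j where j: "(e, j) \<in> set W" by (auto simp: walk_edges_def)
    with ei ord[OF j] have "i = j \<or> i = 1 - j" "i < 2" "j < 2" by (auto simp: less_2_cases_iff)
    then show "(e, i) = t \<or> (e, i) = (fst s, 1 - snd s)"
    proof (elim disjE)
      assume "i = j"
      then have "step_tail G (e, j) = v" using ei by (simp add: step_tail_def)
      then have "(e, j) = t" using dt t j by (auto simp: distinct_map inj_on_def)
      then show ?thesis using \<open>i = j\<close> by simp
    next
      assume "i = 1 - j"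
      then have "step_head G (e, j) = v" using ei by (simp add: step_head_def)
      then have "(e, j) = s" using d(1) s j by (auto simp: distinct_map inj_on_def)
      then show ?thesis using \<open>i = 1 - j\<close> by auto
    qed
  next
    assume "(e, i) = t \<or> (e, i) = (fst s, 1 - snd s)"
    then show "(e, i) \<in> ?E"
      using s t ord[OF s(1)] ord[OF t(1)]
      by (auto simp: walk_edges_def step_tail_def step_head_def intro: rev_image_eqI)
  qed
  then have "?E = {t, (fst s, 1 - snd s)}" by auto
  \<comment> \<open>Equality would put s and t on the same edge, hence make them the same step,
    although their end numbers differ. For a loop s and t do coincide, and its two ends are
    counted.\<close>
  moreover have "t \<noteq> (fst s, 1 - snd s)"
    using edge_inj[OF t(1) s(1)] ord[OF s(1)]
    by (cases s) (auto simp: less_2_cases_iff)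
  ultimately show ?thesis unfolding valency_def by simp
qed

lemma circle_of_cycle:
  assumes "graph G" "cycle G u W"
  shows "circle G (walk_edges W)"
proof -
  have w: "walk G u W u" "W \<noteq> []" using assms(2) by (auto simp: cycle_def)
  have "\<exists>A. walk G x A y \<and> walk_edges A \<subseteq> walk_edges W"
    if x: "x \<in> verts_of G (walk_edges W)" and y: "y \<in> verts_of G (walk_edges W)" for x y
  proof -
    obtain W' where W': "cycle G x W'" "set W' = set W"
      using cycle_rotate[OF assms] x verts_of_cycle(2)[OF assms(2)] by blast
    then have edges: "walk_edges W' = walk_edges W" by (simp add: walk_edges_def)
    then have "y \<in> set (walk_verts G x W')" using y verts_of_cycle(1)[OF W'(1)] by simp
    with W'(1) obtain A B where "W' = A @ B" "walk G x A y"
      using walk_split_at[OF assms(1)] unfolding cycle_def by metis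
    then show ?thesis using edges by auto
  qed
  moreover have "\<forall>e\<in>walk_edges W. ordinary_edge G e"
    using walk_ordinary(1)[OF w(1)] by (auto simp: walk_edges_def)
  moreover have "walk_edges W \<noteq> {}" using w(2) by (simp add: walk_edges_def)
  ultimately show ?thesis
    using cycle_valency[OF assms(2)] unfolding circle_def by blast
qed

lemma circle_walk_of_cycle:
  assumes "cycle G u W"
  shows "circle_walk G (walk_edges W) u W"
  using assms by (auto simp: circle_walk_def cycle_def)

text \<open>The last assumption excludes that Q merely goes back along the edge of s. An empty Q is
  possible, for a loop.\<close>

lemma cycle_of_path:
  assumes "graph G" "ordinary_edge G (fst s)" "snd s < 2"
    and "path G (step_head G s) Q (step_tail G s)" "fst s \<notin> walk_edges Q"
  shows "cycle G (step_tail G s) (s # Q)"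
  using assms path_distinct_edges[OF assms(4)]
  by (auto simp: cycle_def path_def walk_edges_def walk_verts_def)


section \<open>Signs and gains of walks\<close>

lemma oriented_graph: "oriented_signed_graph S \<Longrightarrow> graph S"
  by (simp add: oriented_signed_graph_def)

lemma walk_sign_simps [simp]:
  "walk_sign S [] = 1"
  "walk_sign S (s # W) = esign S (fst s) * walk_sign S W"
  "walk_sign S (A @ B) = walk_sign S A * walk_sign S B"
  by (simp_all add: walk_sign_def)

lemma walk_sign_rev [simp]: "walk_sign S (rev_walk W) = walk_sign S W"
  by (induction W) auto

lemma esign_cases:
  assumes "oriented_signed_graph S" "ordinary_edge S e"
  shows "esign S e = 1 \<or> esign S e = -1"
  using assms by (auto simp: oriented_signed_graph_def ordinary_edge_def)

lemma walk_sign_cases: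
  assumes "oriented_signed_graph S" "walk S u W v"
  shows "walk_sign S W = 1 \<or> walk_sign S W = -1"
  using assms(2)
proof (induction W arbitrary: u)
  case (Cons s W)
  then show ?case using esign_cases[OF assms(1), of "fst s"] by auto
qed simp

text \<open>The point of contact between signs of circles, defined on edge sets, and signs of walks,
  defined on lists. It is also the reason why rotation keeps the sign of a cycle.\<close>

lemma walk_sign_distinct:
  assumes "distinct (map fst W)"
  shows "walk_sign S W = (\<Prod>e\<in>walk_edges W. esign S e)"
  using assms prod.distinct_set_conv_list[of "map fst W" "esign S"]
  by (simp add: walk_sign_def walk_edges_def o_def)

lemma orient_flip:
  assumes "oriented_signed_graph S" "ordinary_edge S e" "i < 2"
  shows "orient S e (1 - i) = - esign S e * orient S e i"
    "orient S e i * orient S e i = 1"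
proof -
  have o: "orient S e 0 = 1 \<or> orient S e 0 = -1" "orient S e 1 = 1 \<or> orient S e 1 = -1"
    "orient S e 0 * orient S e 1 = - esign S e"
    using assms by (auto simp: oriented_signed_graph_def ordinary_edge_def)
  have "i = 0 \<or> i = 1" using assms(3) by auto
  then show "orient S e (1 - i) = - esign S e * orient S e i" "orient S e i * orient S e i = 1"
    using o by auto
qed

lemma walk_gain_Nil [simp]: "walk_gain \<Upsilon> [] = 0"
  by (simp add: walk_gain_def)

lemma walk_gain_Cons [simp]:
  "walk_gain \<Upsilon> (s # W) =
    - (gain \<Upsilon> (fst s) * of_int (orient \<Upsilon> (fst s) (snd s))) +
    of_int (esign \<Upsilon> (fst s)) * walk_gain \<Upsilon> W"
  by (simp add: walk_gain_def sum.lessThan_Suc_shift sum_distrib_left algebra_simps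
      del: sum.lessThan_Suc)

lemma walk_gain_append [simp]:
  "walk_gain \<Upsilon> (A @ B) = walk_gain \<Upsilon> A + of_int (walk_sign \<Upsilon> A) * walk_gain \<Upsilon> B"
  by (induction A) (auto simp: algebra_simps)

lemma walk_gain_rev:
  assumes "oriented_signed_graph \<Upsilon>" "walk \<Upsilon> u W v"
  shows "walk_gain \<Upsilon> (rev_walk W) = - of_int (walk_sign \<Upsilon> W) * walk_gain \<Upsilon> W"
  using assms(2)
proof (induction W arbitrary: u)
  case (Cons s W)
  then have s: "ordinary_edge \<Upsilon> (fst s)" "snd s < 2" by auto
  have IH: "walk_gain \<Upsilon> (rev_walk W) = - of_int (walk_sign \<Upsilon> W) * walk_gain \<Upsilon> W"
    using Cons.IH Cons.prems by auto
  have o: "orient \<Upsilon> (fst s) (Suc 0 - snd s) = - esign \<Upsilon> (fst s) * orient \<Upsilon> (fst s) (snd s)"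
    using orient_flip(1)[OF assms(1) s] by simp
  show ?case
    using esign_cases[OF assms(1) s(1)] by (auto simp: IH o algebra_simps)
qed simp


section \<open>Negative figures and handcuffs\<close>

text \<open>
  The weight of a half edge \<open>h\<close> at \<open>u\<close> is that of a negative loop traversing \<open>h\<close> forth and back.
  With this convention the gains of all three kinds of handcuffs vanish under the same condition.
\<close>

definition figure_weight ::
  "('v, 'e, 'k::field) gain_signed_graph \<Rightarrow> 'e set \<Rightarrow> 'v \<Rightarrow> 'k \<Rightarrow> bool" where
  "figure_weight \<Upsilon> C u k \<longleftrightarrow>
     (\<exists>h. half_edge \<Upsilon> h \<and> C = {h} \<and> ends \<Upsilon> h = [u] \<and>
        k = - 2 * (of_int (orient \<Upsilon> h 0) * gain \<Upsilon> h)) \<or>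
     (\<exists>W. cycle \<Upsilon> u W \<and> walk_sign \<Upsilon> W = -1 \<and> C = walk_edges W \<and> k = walk_gain \<Upsilon> W)"

lemma figure_weight_cases [consumes 1, case_names half cycle]:
  assumes "figure_weight \<Upsilon> C u k"
  obtains (half) h where "half_edge \<Upsilon> h" "C = {h}" "ends \<Upsilon> h = [u]"
      "k = - 2 * (of_int (orient \<Upsilon> h 0) * gain \<Upsilon> h)"
    | (cycle) W where "cycle \<Upsilon> u W" "walk_sign \<Upsilon> W = -1" "C = walk_edges W"
      "k = walk_gain \<Upsilon> W"
  using assms unfolding figure_weight_def by blast

lemma edge_kind_cases:
  assumes "graph G" "e \<in> edges G"
  shows "loose_edge G e \<or> half_edge G e \<or> ordinary_edge G e"
proof -
  have "length (ends G e) \<le> 2" using assms by (simp add: graph_def)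
  then have "length (ends G e) = 0 \<or> length (ends G e) = 1 \<or> length (ends G e) = 2" by linarith
  then show ?thesis using assms(2) by (auto simp: loose_edge_def half_edge_def ordinary_edge_def)
qed

lemma half_edge_ends:
  assumes "half_edge G h"
  obtains u where "ends G h = [u]"
  using assms by (auto simp: half_edge_def length_Suc_conv)

lemma cycle_negative_circle:
  assumes "oriented_signed_graph S" "cycle S u W" "walk_sign S W = -1"
  shows "negative_circle S (walk_edges W)"
  using assms(2,3) circle_of_cycle[OF oriented_graph[OF assms(1)] assms(2)] walk_sign_distinct[of W S]
  by (simp add: negative_circle_def cycle_def)

lemma figure_weight_negative_figure:
  assumes "oriented_signed_graph \<Upsilon>" "figure_weight \<Upsilon> C u k"
  shows "negative_figure \<Upsilon> C" "u \<in> verts_of \<Upsilon> C" "u \<in> verts \<Upsilon>" "C \<subseteq> edges \<Upsilon>"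
proof -
  note g = oriented_graph[OF assms(1)]
  have "negative_figure \<Upsilon> C \<and> u \<in> verts_of \<Upsilon> C \<and> u \<in> verts \<Upsilon> \<and> C \<subseteq> edges \<Upsilon>"
    using assms(2)
  proof (cases rule: figure_weight_cases)
    case (half h)
    then have "h \<in> edges \<Upsilon>" by (simp add: half_edge_def)
    then have "set (ends \<Upsilon> h) \<subseteq> verts \<Upsilon>" using g unfolding graph_def by blast
    then show ?thesis using half \<open>h \<in> edges \<Upsilon>\<close> by (auto simp: negative_figure_def verts_of_def)
  next
    case (cycle W)
    then have w: "walk \<Upsilon> u W u" by (simp add: cycle_def)
    then have "u \<in> verts \<Upsilon>" using walk_verts_in[OF g] by blast
    moreover have "walk_edges W \<subseteq> edges \<Upsilon>"
      using walk_ordinary(1)[OF w] by (auto simp: walk_edges_def ordinary_edge_def)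
    ultimately show ?thesis
      using cycle cycle_negative_circle[OF assms(1)] verts_of_cycle(1)[of \<Upsilon> u W]
      by (auto simp: negative_figure_def)
  qed
  then show "negative_figure \<Upsilon> C" "u \<in> verts_of \<Upsilon> C" "u \<in> verts \<Upsilon>" "C \<subseteq> edges \<Upsilon>" by auto
qed

text \<open>The new weight is left open because the gain of a negative cycle varies with its base
  point; in the presence of a potential it is recovered as \<open>2 * \<theta> v\<close>. The walk
  inside C makes all vertices of a figure linked to each other.\<close>

lemma figure_weight_move:
  assumes "oriented_signed_graph \<Upsilon>" "figure_weight \<Upsilon> C u k" "v \<in> verts_of \<Upsilon> C"
  obtains k' W where "figure_weight \<Upsilon> C v k'" "walk \<Upsilon> u W v" "walk_edges W \<subseteq> C"
  using assms(2)
proof (cases rule: figure_weight_cases)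
  case (half h)
  then have "v = u" using assms(3) by (simp add: verts_of_def)
  then show thesis
    using that[of k "[]"] assms(2) figure_weight_negative_figure(3)[OF assms(1,2)] by simp
next
  case (cycle W)
  note g = oriented_graph[OF assms(1)]
  have circ: "circle \<Upsilon> C" using circle_of_cycle[OF g cycle(1)] cycle(3) by simp
  obtain W' where W': "cycle \<Upsilon> v W'" "set W' = set W"
    using cycle_rotate[OF g cycle(1)] assms(3) verts_of_cycle(2)[OF cycle(1)] cycle(3) by blast
  then have "walk_edges W' = walk_edges W" by (simp add: walk_edges_def)
  moreover from this have "walk_sign \<Upsilon> W' = -1"
    using walk_sign_distinct W'(1) cycle(1,2) unfolding cycle_def by metis
  ultimately have "figure_weight \<Upsilon> C v (walk_gain \<Upsilon> W')"
    using W'(1) cycle(3) unfolding figure_weight_def by blast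
  moreover obtain P where "walk \<Upsilon> u P v" "walk_edges P \<subseteq> C"
    using circ figure_weight_negative_figure(2)[OF assms(1,2)] assms(3) unfolding circle_def by blast
  ultimately show thesis using that by blast
qed

section \<open>Neutrality of sign circuits as equations between weights\<close>

lemma hyperbalanced_circuit_walk:
  assumes "hyperbalanced \<Upsilon>" "circuit_walk \<Upsilon> F h W h'" "sign_circuit \<Upsilon> F" "F \<subseteq> edges \<Upsilon>"
  shows "ultrawalk_gain \<Upsilon> h W h' = 0"
  using assms(1,3,4) circuit_gain.walk[OF assms(2)]
  by (simp add: hyperbalanced_def neutral_circuit_def)

lemma hyperbalanced_positive_cycle:
  assumes "oriented_signed_graph \<Upsilon>" "hyperbalanced \<Upsilon>" "cycle \<Upsilon> u W" "walk_sign \<Upsilon> W = 1"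
  shows "walk_gain \<Upsilon> W = 0"
proof -
  have w: "walk \<Upsilon> u W u" and d: "distinct (map fst W)" using assms(3) by (auto simp: cycle_def)
  have pos: "positive_circle \<Upsilon> (walk_edges W)"
    using circle_of_cycle[OF oriented_graph assms(3)] assms(1,4) walk_sign_distinct[OF d, of \<Upsilon>]
    by (simp add: positive_circle_def)
  have "walk_edges W \<subseteq> edges \<Upsilon>"
    using walk_ordinary(1)[OF w] by (auto simp: walk_edges_def ordinary_edge_def)
  moreover have "sign_circuit \<Upsilon> (walk_edges W)" using pos by (simp add: sign_circuit_def)
  ultimately have "ultrawalk_gain \<Upsilon> None W None = 0"
    using hyperbalanced_circuit_walk[OF assms(2)
        circuit_walk.positive_circle[OF pos circle_walk_of_cycle[OF assms(3)]]] by blast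
  then show ?thesis by (simp add: ultrawalk_gain_def)
qed

text \<open>The circuit walk for a half edge and a circle starts at the half edge; if the half edge
  is the second figure, the handcuff has to be read backwards.\<close>

lemma handcuff_sym:
  assumes "graph S" "handcuff S C\<^sub>1 u P v C\<^sub>2"
  shows "handcuff S C\<^sub>2 v (rev_walk P) u C\<^sub>1"
proof -
  have P: "path S u P v" using assms(2) by (simp add: handcuff_def)
  then have "set (walk_verts S v (rev_walk P)) = set (walk_verts S u P)"
    using walk_verts_rev[of S u P v] by (simp add: path_def)
  moreover have "verts_of S C\<^sub>1 \<inter> verts_of S C\<^sub>2 = {u} \<Longrightarrow> P = [] \<Longrightarrow> u = v"
    using P by (simp add: path_def)
  ultimately show ?thesis
    using assms(2) path_rev[OF assms(1) P] unfolding handcuff_def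
    by (simp add: Int_commute Un_commute insert_commute) (metis rev_walk_simps(1))
qed

text \<open>The turn around a negative circle \<open>C\<^sub>2\<close> reverses the sign, so the way
  back along P contributes the gain of P a second time instead of cancelling it; hence the factor 2.
  A half edge \<open>C\<^sub>1\<close> before a circle occurs at both ends of the circuit walk with
  equal contributions, which is its doubled weight.\<close>

lemma handcuff_weight_eq:
  assumes ori: "oriented_signed_graph \<Upsilon>" and hyp: "hyperbalanced \<Upsilon>"
    and C1: "figure_weight \<Upsilon> C\<^sub>1 u k\<^sub>1" and C2: "figure_weight \<Upsilon> C\<^sub>2 v k\<^sub>2"
    and cuff: "handcuff \<Upsilon> C\<^sub>1 u P v C\<^sub>2"
  shows "k\<^sub>1 = 2 * walk_gain \<Upsilon> P + of_int (walk_sign \<Upsilon> P) * k\<^sub>2"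
proof -
  note g = oriented_graph[OF ori]
  have walk_P: "walk \<Upsilon> u P v" using cuff by (simp add: handcuff_def path_def)
  have sgn: "walk_sign \<Upsilon> P = 1 \<or> walk_sign \<Upsilon> P = -1" using walk_sign_cases[OF ori walk_P] .
  have "walk_edges P \<subseteq> edges \<Upsilon>"
    using walk_ordinary(1)[OF walk_P] by (auto simp: walk_edges_def ordinary_edge_def)
  then have sub: "C\<^sub>1 \<union> walk_edges P \<union> C\<^sub>2 \<subseteq> edges \<Upsilon>"
    using figure_weight_negative_figure(4)[OF ori C1] figure_weight_negative_figure(4)[OF ori C2]
    by simp
  have circuit: "sign_circuit \<Upsilon> (C\<^sub>1 \<union> walk_edges P \<union> C\<^sub>2)"
    using cuff unfolding sign_circuit_def by blast
  have zero: "ultrawalk_gain \<Upsilon> h W h' = 0"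
    if "circuit_walk \<Upsilon> (C\<^sub>1 \<union> walk_edges P \<union> C\<^sub>2) h W h'" for h W h'
    using hyperbalanced_circuit_walk[OF hyp that circuit sub] .
  have rev_P: "walk_gain \<Upsilon> (rev_walk P) = - of_int (walk_sign \<Upsilon> P) * walk_gain \<Upsilon> P"
    using walk_gain_rev[OF ori walk_P] .
  have rev_rev_P: "walk_gain \<Upsilon> (rev_walk (rev_walk P)) = walk_gain \<Upsilon> P"
    using walk_gain_rev[OF ori walk_rev[OF g walk_P]] rev_P sgn by auto
  have "2 * walk_gain \<Upsilon> P + of_int (walk_sign \<Upsilon> P) * k\<^sub>2 - k\<^sub>1 = 0"
    using C1
  proof (cases rule: figure_weight_cases)
    case half1: (half h)
    show ?thesis
      using C2
    proof (cases rule: figure_weight_cases)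
      case half2: (half h')
      have "ultrawalk_gain \<Upsilon> (Some h) P (Some h') = 0"
        using cuff half1(1) half2(1) unfolding half1(2) half2(2)
        by (intro zero[unfolded half1(2) half2(2)] circuit_walk.half_half)
      \<comment> \<open>Between two half edges P is traversed only once; doubling the equation
        brings it to the form of the other cases.\<close>
      then have "2 * (of_int (orient \<Upsilon> h 0) * gain \<Upsilon> h + walk_gain \<Upsilon> P
          - gain \<Upsilon> h' * of_int (walk_sign \<Upsilon> P) * of_int (orient \<Upsilon> h' 0)) = 0"
        by (simp add: ultrawalk_gain_def)
      then show ?thesis unfolding half1(4) half2(4) by (simp add: algebra_simps)
    next
      case cycle2: (cycle W)
      have "ultrawalk_gain \<Upsilon> (Some h) (P @ W @ rev_walk P) (Some h) = 0"
        using cuff half1(1) cycle_negative_circle[OF ori cycle2(1,2)]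
          circle_walk_of_cycle[OF cycle2(1)] unfolding half1(2) cycle2(3)
        by (intro zero[unfolded half1(2) cycle2(3)] circuit_walk.half_circle)
      then show ?thesis
        using sgn unfolding half1(4) cycle2(4)
        by (elim disjE) (simp_all add: ultrawalk_gain_def cycle2(2) rev_P algebra_simps)
    qed
  next
    case cycle1: (cycle W\<^sub>1)
    show ?thesis
      using C2
    proof (cases rule: figure_weight_cases)
      case half2: (half h)
      have "circuit_walk \<Upsilon> ({h} \<union> walk_edges (rev_walk P) \<union> walk_edges W\<^sub>1) (Some h)
          (rev_walk P @ W\<^sub>1 @ rev_walk (rev_walk P)) (Some h)"
        using handcuff_sym[OF g cuff] half2(1) cycle_negative_circle[OF ori cycle1(1,2)]
          circle_walk_of_cycle[OF cycle1(1)] unfolding half2(2) cycle1(3)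
        by (rule circuit_walk.half_circle)
      moreover have "{h} \<union> walk_edges (rev_walk P) \<union> walk_edges W\<^sub>1 = C\<^sub>1 \<union> walk_edges P \<union> C\<^sub>2"
        unfolding half2(2) cycle1(3) by auto
      ultimately have "ultrawalk_gain \<Upsilon> (Some h)
          (rev_walk P @ W\<^sub>1 @ rev_walk (rev_walk P)) (Some h) = 0"
        using zero by metis
      then show ?thesis
        using sgn unfolding half2(4) cycle1(4)
        by (elim disjE)
          (simp_all add: ultrawalk_gain_def cycle1(2) rev_P rev_rev_P algebra_simps)
    next
      case cycle2: (cycle W)
      have "ultrawalk_gain \<Upsilon> None (W\<^sub>1 @ P @ W @ rev_walk P) None = 0"
        using cuff cycle_negative_circle[OF ori cycle1(1,2)] cycle_negative_circle[OF ori cycle2(1,2)]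
          circle_walk_of_cycle[OF cycle1(1)] circle_walk_of_cycle[OF cycle2(1)]
        unfolding cycle1(3) cycle2(3)
        by (intro zero[unfolded cycle1(3) cycle2(3)] circuit_walk.circle_circle)
      then show ?thesis
        using sgn unfolding cycle1(4) cycle2(4)
        by (elim disjE)
          (simp_all add: ultrawalk_gain_def cycle1(2) cycle2(2) rev_P algebra_simps)
    qed
  qed
  then show ?thesis by simp
qed

text \<open>Upgrades an arbitrary walk between two figures to a handcuff: disjoint figures are
  joined by a trimmed path inside W, figures with one common vertex by the empty path there. Figures
  with several common vertices form no handcuff, hence the assumption on the intersection.\<close>

lemma linked_figures:
  assumes ori: "oriented_signed_graph \<Upsilon>" and hyp: "hyperbalanced \<Upsilon>"
    and C1: "figure_weight \<Upsilon> C\<^sub>1 a k" and C2: "figure_weight \<Upsilon> C\<^sub>2 b l" and "C\<^sub>1 \<noteq> C\<^sub>2"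
    and W: "walk \<Upsilon> a W b" and meet: "verts_of \<Upsilon> C\<^sub>1 \<inter> verts_of \<Upsilon> C\<^sub>2 \<subseteq> {z}"
  obtains u P v k\<^sub>1 k\<^sub>2 where "figure_weight \<Upsilon> C\<^sub>1 u k\<^sub>1" "figure_weight \<Upsilon> C\<^sub>2 v k\<^sub>2"
    "path \<Upsilon> u P v" "walk_edges P \<subseteq> walk_edges W"
    "k\<^sub>1 = 2 * walk_gain \<Upsilon> P + of_int (walk_sign \<Upsilon> P) * k\<^sub>2"
proof -
  note g = oriented_graph[OF ori]
  note fig1 = figure_weight_negative_figure[OF ori C1]
  note fig2 = figure_weight_negative_figure[OF ori C2]
  have "\<exists>u P v. walk_edges P \<subseteq> walk_edges W \<and> handcuff \<Upsilon> C\<^sub>1 u P v C\<^sub>2"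
  proof (cases "verts_of \<Upsilon> C\<^sub>1 \<inter> verts_of \<Upsilon> C\<^sub>2 = {}")
    case True
    obtain u P v where P: "path \<Upsilon> u P v" "walk_edges P \<subseteq> walk_edges W"
      "set (walk_verts \<Upsilon> u P) \<inter> verts_of \<Upsilon> C\<^sub>1 = {u}" "set (walk_verts \<Upsilon> u P) \<inter> verts_of \<Upsilon> C\<^sub>2 = {v}"
      using path_between_sets[OF g W fig1(2) fig2(2)] by blast
    then have "handcuff \<Upsilon> C\<^sub>1 u P v C\<^sub>2"
      using True fig1(1) fig2(1) \<open>C\<^sub>1 \<noteq> C\<^sub>2\<close> unfolding handcuff_def by blast
    then show ?thesis using P(2) by blast
  next
    case False
    then have z: "verts_of \<Upsilon> C\<^sub>1 \<inter> verts_of \<Upsilon> C\<^sub>2 = {z}" using meet by blast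
    then have "z \<in> verts_of \<Upsilon> C\<^sub>1" by blast
    \<comment> \<open>Moving the weight to z shows that z is a vertex of the graph, as the empty
      path at z requires.\<close>
    then obtain k' where "figure_weight \<Upsilon> C\<^sub>1 z k'" using figure_weight_move[OF ori C1] by blast
    then have "path \<Upsilon> z [] z" using figure_weight_negative_figure(3)[OF ori] by (auto simp: path_def)
    then have "handcuff \<Upsilon> C\<^sub>1 z [] z C\<^sub>2"
      using z fig1(1) fig2(1) \<open>C\<^sub>1 \<noteq> C\<^sub>2\<close> unfolding handcuff_def by blast
    then show ?thesis by (intro exI[of _ z] exI[of _ "[]"]) auto
  qed
  then obtain u P v where P: "walk_edges P \<subseteq> walk_edges W" "handcuff \<Upsilon> C\<^sub>1 u P v C\<^sub>2" by blast
  then have "u \<in> verts_of \<Upsilon> C\<^sub>1" "v \<in> verts_of \<Upsilon> C\<^sub>2" "path \<Upsilon> u P v" by (auto simp: handcuff_def)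
  moreover from this obtain k\<^sub>1 k\<^sub>2 where "figure_weight \<Upsilon> C\<^sub>1 u k\<^sub>1" "figure_weight \<Upsilon> C\<^sub>2 v k\<^sub>2"
    using figure_weight_move[OF ori C1] figure_weight_move[OF ori C2] by metis
  ultimately show thesis using that handcuff_weight_eq[OF ori hyp _ _ P(2)] P(1) by blast
qed


section \<open>Gain switching\<close>

lemma switched_gain_step:
  assumes "ordinary_edge \<Upsilon> (fst s)" "snd s < 2"
  shows "switched_gain \<Upsilon> \<theta> (fst s) =
    of_int (orient \<Upsilon> (fst s) (snd s)) * \<theta> (step_tail \<Upsilon> s) + gain \<Upsilon> (fst s) +
    of_int (orient \<Upsilon> (fst s) (1 - snd s)) * \<theta> (step_head \<Upsilon> s)"
proof -
  from assms(1) obtain v w where "ends \<Upsilon> (fst s) = [v, w]"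
    by (auto simp: ordinary_edge_def length_Suc_conv numeral_2_eq_2)
  moreover have "snd s = 0 \<or> snd s = 1" using assms(2) by auto
  ultimately show ?thesis
    by (auto simp: switched_gain_def step_tail_def step_head_def algebra_simps)
qed

text \<open>The term with the switched gain is the deviation from a pure potential difference. It
  vanishes on F, and it is what makes a walk through the new edge detectable.\<close>

lemma step_gain:
  assumes "oriented_signed_graph \<Upsilon>" "ordinary_edge \<Upsilon> (fst s)" "snd s < 2"
  shows "- (gain \<Upsilon> (fst s) * of_int (orient \<Upsilon> (fst s) (snd s))) =
    \<theta> (step_tail \<Upsilon> s) - of_int (esign \<Upsilon> (fst s)) * \<theta> (step_head \<Upsilon> s)
    - of_int (orient \<Upsilon> (fst s) (snd s)) * (switched_gain \<Upsilon> \<theta> (fst s) :: 'k::field)"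
proof -
  define t :: 'k where "t = of_int (orient \<Upsilon> (fst s) (snd s))"
  have "of_int (orient \<Upsilon> (fst s) (1 - snd s)) = - of_int (esign \<Upsilon> (fst s)) * t"
    using orient_flip(1)[OF assms] unfolding t_def by (simp only: of_int_mult of_int_minus)
  moreover have tt: "t * t = 1"
    using orient_flip(2)[OF assms] unfolding t_def by (metis of_int_mult of_int_1)
  moreover have "t * (t * a + c + (- d * t) * b) = (t * t) * a + t * c - (t * t) * (d * b)"
    for a b c d by (simp add: algebra_simps)
  ultimately show ?thesis
    unfolding switched_gain_step[OF assms(2,3)] t_def[symmetric] by simp
qed

lemma walk_gain_potential:
  assumes "oriented_signed_graph \<Upsilon>" "\<forall>f\<in>F. switched_gain \<Upsilon> \<theta> f = 0"
    and "walk \<Upsilon> u W v" "walk_edges W \<subseteq> F"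
  shows "walk_gain \<Upsilon> W = \<theta> u - of_int (walk_sign \<Upsilon> W) * \<theta> v"
  using assms(3,4)
proof (induction W arbitrary: u)
  case (Cons s W)
  then have "- (gain \<Upsilon> (fst s) * of_int (orient \<Upsilon> (fst s) (snd s))) =
      \<theta> u - of_int (esign \<Upsilon> (fst s)) * \<theta> (step_head \<Upsilon> s)"
    using step_gain[OF assms(1), of s \<theta>] assms(2) by simp
  moreover have "walk_gain \<Upsilon> W = \<theta> (step_head \<Upsilon> s) - of_int (walk_sign \<Upsilon> W) * \<theta> v"
    using Cons by simp
  ultimately show ?case by (simp only: walk_gain_Cons walk_sign_simps of_int_mult) (simp add: algebra_simps)
qed simp

lemma half_edge_gain:
  assumes "oriented_signed_graph \<Upsilon>" "half_edge \<Upsilon> h" "ends \<Upsilon> h = [u]"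
  shows "of_int (orient \<Upsilon> h 0) * gain \<Upsilon> h =
    of_int (orient \<Upsilon> h 0) * switched_gain \<Upsilon> \<theta> h - \<theta> u"
    "orient \<Upsilon> h 0 = 1 \<or> orient \<Upsilon> h 0 = -1"
proof -
  show o: "orient \<Upsilon> h 0 = 1 \<or> orient \<Upsilon> h 0 = -1"
    using assms by (force simp: oriented_signed_graph_def half_edge_def)
  then show "of_int (orient \<Upsilon> h 0) * gain \<Upsilon> h =
    of_int (orient \<Upsilon> h 0) * switched_gain \<Upsilon> \<theta> h - \<theta> u"
    using assms(3) by (auto simp: switched_gain_def)
qed

text \<open>The sign -1 makes the two potential terms of a closed walk add up instead of cancelling;
  the weight of a half edge is doubled to match.\<close>

lemma figure_weight_potential:
  assumes "oriented_signed_graph \<Upsilon>" "\<forall>f\<in>F. switched_gain \<Upsilon> \<theta> f = 0"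
    and "figure_weight \<Upsilon> C u k" "C \<subseteq> F"
  shows "k = 2 * \<theta> u"
  using assms(3)
proof (cases rule: figure_weight_cases)
  case (half h)
  then show ?thesis using half_edge_gain(1)[OF assms(1) half(1,3), of \<theta>] assms(2,4) by simp
next
  case (cycle W)
  then show ?thesis
    using walk_gain_potential[OF assms(1,2), of u W u] assms(4) by (simp add: cycle_def)
qed

section \<open>From a gain switcher to hyperbalance\<close>

lemma switching_imp_hyperbalanced:
  assumes ori: "oriented_signed_graph \<Upsilon>" and pot: "\<forall>e\<in>edges \<Upsilon>. switched_gain \<Upsilon> \<theta> e = 0"
  shows "hyperbalanced \<Upsilon>"
proof -
  note g = oriented_graph[OF ori]
  have wg: "walk_gain \<Upsilon> W = \<theta> u - of_int (walk_sign \<Upsilon> W) * \<theta> v" if "walk \<Upsilon> u W v" for u W v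
  proof (rule walk_gain_potential[OF ori pot that])
    show "walk_edges W \<subseteq> edges \<Upsilon>"
      using walk_ordinary(1)[OF that] by (auto simp: walk_edges_def ordinary_edge_def)
  qed
  have half: "of_int (orient \<Upsilon> h 0) * gain \<Upsilon> h = - \<theta> u"
    if "half_edge \<Upsilon> h" "u \<in> verts_of \<Upsilon> {h}" for h u
  proof -
    have "ends \<Upsilon> h = [u]" using that half_edge_ends[OF that(1)] by (force simp: verts_of_def)
    then show ?thesis
      using half_edge_gain(1)[OF ori that(1), of u \<theta>] pot that(1) by (simp add: half_edge_def)
  qed
  have half_end: "gain \<Upsilon> h * x * of_int (orient \<Upsilon> h 0) = - (x * \<theta> u)"
    if "half_edge \<Upsilon> h" "u \<in> verts_of \<Upsilon> {h}" for h u x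
    using half[OF that] by (metis mult.commute mult.left_commute mult_minus_right)
  have circle: "walk \<Upsilon> u W u \<and> walk_sign \<Upsilon> W = (\<Prod>e\<in>C. esign \<Upsilon> e)"
    if "circle_walk \<Upsilon> C u W" for C u W
    using that walk_sign_distinct[of W \<Upsilon>] by (simp add: circle_walk_def)
  have zero: "ultrawalk_gain \<Upsilon> h W h' = 0" if "circuit_walk \<Upsilon> F h W h'" for F h W h'
    using that
  proof (cases rule: circuit_walk.cases)
    case (positive_circle u)
    then have "walk \<Upsilon> u W u" "walk_sign \<Upsilon> W = 1"
      using circle by (auto simp: positive_circle_def)
    then show ?thesis using wg positive_circle by (simp add: ultrawalk_gain_def)
  next
    case (circle_circle C\<^sub>1 u P v C\<^sub>2 W\<^sub>1 W\<^sub>2)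
    have P: "walk \<Upsilon> u P v" using circle_circle by (simp add: handcuff_def path_def)
    have W1: "walk \<Upsilon> u W\<^sub>1 u" "walk_sign \<Upsilon> W\<^sub>1 = -1"
      using circle[OF circle_circle(8)] circle_circle(6) by (auto simp: negative_circle_def)
    have W2: "walk \<Upsilon> v W\<^sub>2 v" "walk_sign \<Upsilon> W\<^sub>2 = -1"
      using circle[OF circle_circle(9)] circle_circle(7) by (auto simp: negative_circle_def)
    have "walk \<Upsilon> u W u" unfolding circle_circle
      using P W1 W2 walk_rev[OF g P] by (intro walk_appendI[OF g])
    \<comment> \<open>The two negative circles contribute -1 each, and P contributes its sign
      twice.\<close>
    moreover have "walk_sign \<Upsilon> W = 1" unfolding circle_circle
      using walk_sign_cases[OF ori P] by (auto simp: W1 W2)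
    ultimately show ?thesis using wg[of u W u] circle_circle(2,4) by (simp add: ultrawalk_gain_def)
  next
    case (half_circle h\<^sub>0 u P v C W')
    have P: "walk \<Upsilon> u P v" "u \<in> verts_of \<Upsilon> {h\<^sub>0}"
      using half_circle by (auto simp: handcuff_def path_def)
    have W': "walk \<Upsilon> v W' v" "walk_sign \<Upsilon> W' = -1"
      using circle[OF half_circle(8)] half_circle(7) by (auto simp: negative_circle_def)
    have "walk \<Upsilon> u W u" unfolding half_circle
      using P W' walk_rev[OF g P(1)] by (intro walk_appendI[OF g])
    \<comment> \<open>The closed walk W has sign -1 and gain \<open>2 * \<theta> u\<close>; the half
      edge contributes \<open>- \<theta> u\<close> at the start and again at the end.\<close>
    then show ?thesis
      using wg[of u W u] half[OF half_circle(6) P(2)] half_end[OF half_circle(6) P(2)] half_circle(2,4)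
      by (simp add: ultrawalk_gain_def)
  next
    case (half_half h\<^sub>0 u v h\<^sub>1)
    have P: "walk \<Upsilon> u W v" "u \<in> verts_of \<Upsilon> {h\<^sub>0}" "v \<in> verts_of \<Upsilon> {h\<^sub>1}"
      using half_half by (auto simp: handcuff_def path_def)
    then show ?thesis
      using wg[OF P(1)] half[OF _ P(2)] half_end[OF _ P(3)] half_half
      by (simp add: ultrawalk_gain_def)
  qed
  have "k = 0" if "circuit_gain \<Upsilon> F k" for F k
    using that
  proof (cases rule: circuit_gain.cases)
    case (loose e)
    then show ?thesis using pot by (auto simp: switched_gain_def loose_edge_def)
  next
    case (walk h W h')
    then show ?thesis using zero by simp
  qed
  then show ?thesis by (auto simp: hyperbalanced_def neutral_circuit_def)
qed


section \<open>Reaching negative figures\<close>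

definition linked :: "('v, 'e, 'z) graph_scheme \<Rightarrow> 'e set \<Rightarrow> 'v \<Rightarrow> 'v \<Rightarrow> bool" where
  "linked G F u v \<longleftrightarrow> (\<exists>W. walk G u W v \<and> walk_edges W \<subseteq> F)"

text \<open>A figure at x forces the value of \<open>2 * \<theta> x\<close> for every \<theta> whose
  switched gains vanish on F, and a walk in F carries this over to u. At a pinned vertex there is
  thus no freedom left when 2 is invertible.\<close>

definition pinned :: "('v, 'e, 'k::field) gain_signed_graph \<Rightarrow> 'e set \<Rightarrow> 'v \<Rightarrow> bool" where
  "pinned \<Upsilon> F u \<longleftrightarrow> (\<exists>C x k. figure_weight \<Upsilon> C x k \<and> C \<subseteq> F \<and> linked \<Upsilon> F u x)"

lemma linkedI: "walk G u W v \<Longrightarrow> walk_edges W \<subseteq> F \<Longrightarrow> linked G F u v"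
  by (auto simp: linked_def)

lemma linked_trans: "graph G \<Longrightarrow> linked G F u v \<Longrightarrow> linked G F v w \<Longrightarrow> linked G F u w"
  unfolding linked_def by (metis walk_appendI walk_edges_simps(3) Un_subset_iff)

lemma linked_sym: "graph G \<Longrightarrow> linked G F u v \<Longrightarrow> linked G F v u"
  unfolding linked_def by (metis walk_rev walk_edges_simps(4))

lemma pinned_linked: "graph \<Upsilon> \<Longrightarrow> linked \<Upsilon> F u v \<Longrightarrow> pinned \<Upsilon> F v \<Longrightarrow> pinned \<Upsilon> F u"
  unfolding pinned_def using linked_trans by metis

text \<open>Cut the walk at a repeated vertex: the signs of the two closed pieces multiply to -1, so
  one of them is negative and shorter. A negative closed walk without repeated heads and edges is a
  negative cycle.\<close>

lemma negative_closed_walk_pinned: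
  assumes "oriented_signed_graph \<Upsilon>" "walk \<Upsilon> u W u" "walk_edges W \<subseteq> F" "walk_sign \<Upsilon> W = -1"
  shows "pinned \<Upsilon> F u"
  using assms(2-4)
proof (induction "length W" arbitrary: u W rule: less_induct)
  case less
  note g = oriented_graph[OF assms(1)]
  have split: ?case if W: "W = A @ B @ D" and walks: "walk \<Upsilon> u A x" "walk \<Upsilon> x B x" "walk \<Upsilon> x D u"
    and len: "B \<noteq> []" "A @ D \<noteq> []" for A B D x
  proof -
    have closed: "walk \<Upsilon> u (A @ D) u" using walks walk_appendI[OF g] by blast
    have "linked \<Upsilon> F u x" using walks less.prems(2) W by (auto intro: linkedI)
    have "walk_sign \<Upsilon> B = -1 \<or> walk_sign \<Upsilon> (A @ D) = -1"
      using less.prems(3) walk_sign_cases[OF assms(1) walks(2)] unfolding W by auto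
    then show ?thesis
    proof
      assume "walk_sign \<Upsilon> B = -1"
      moreover have "length B < length W" "walk_edges B \<subseteq> F" using W len less.prems(2) by auto
      ultimately have "pinned \<Upsilon> F x" using less.hyps walks(2) by blast
      then show ?thesis using \<open>linked \<Upsilon> F u x\<close> pinned_linked[OF g] by blast
    next
      assume "walk_sign \<Upsilon> (A @ D) = -1"
      moreover have "length (A @ D) < length W" "walk_edges (A @ D) \<subseteq> F"
        using W len less.prems(2) by auto
      ultimately show ?thesis using less.hyps closed by blast
    qed
  qed
  show ?case
  proof (cases "distinct (map (step_head \<Upsilon>) W)")
    case False
    then show ?thesis
      using walk_closed_decomp[OF g less.prems(1)] split by (metis append_is_Nil_conv)
  next
    case heads: True
    show ?thesis
    proof (cases "distinct (map fst W)")
      case True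
      then have "cycle \<Upsilon> u W" using heads less.prems(1,3) by (auto simp: cycle_def)
      then have "figure_weight \<Upsilon> (walk_edges W) u (walk_gain \<Upsilon> W)"
        using less.prems(3) unfolding figure_weight_def by blast
      moreover have "linked \<Upsilon> F u u"
        using walk_verts_in(1)[OF g less.prems(1)] by (intro linkedI[of _ _ "[]"]) auto
      ultimately show ?thesis unfolding pinned_def using less.prems(2) by blast
    next
      case False
      then obtain xs e ys zs where "map fst W = xs @ [e] @ ys @ [e] @ zs"
        using not_distinct_decomp by blast
      then obtain A s B t D where W: "W = A @ s # B @ t # D" and st: "fst s = e" "fst t = e"
        by (auto simp: map_eq_append_conv map_eq_Cons_conv Cons_eq_map_conv append_eq_map_conv)
      \<comment> \<open>Equal steps would have equal heads, so the edge is traversed once in each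
        direction, and B is a closed walk at its far end.\<close>
      have "s \<noteq> t" using heads unfolding W by auto
      moreover have s2: "snd s < 2" "ordinary_edge \<Upsilon> e" "snd t < 2"
        using walk_ordinary[OF less.prems(1), of s] walk_ordinary[OF less.prems(1), of t] W st by auto
      ultimately have "t = (e, 1 - snd s)"
        using st by (cases s; cases t) (auto simp: less_2_cases_iff)
      then have t: "step_tail \<Upsilon> t = step_head \<Upsilon> s" "step_head \<Upsilon> t = step_tail \<Upsilon> s"
        using st s2 by (cases s; simp)+
      have walks: "walk \<Upsilon> u A (step_tail \<Upsilon> s)" "walk \<Upsilon> (step_head \<Upsilon> s) B (step_head \<Upsilon> s)"
        "walk \<Upsilon> (step_tail \<Upsilon> s) D u"
        using less.prems(1) t unfolding W by (auto simp: walk_append[OF g])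
      show ?thesis
      proof (cases "B = []")
        case False
        have "walk \<Upsilon> u (A @ [s]) (step_head \<Upsilon> s)"
          using walks(1) s2 st step_ends_in_verts[OF g] by (intro walk_appendI[OF g]) auto
        moreover have "walk \<Upsilon> (step_head \<Upsilon> s) (t # D) u"
          using walks(3) t s2 st by simp
        ultimately show ?thesis
          using split[of "A @ [s]" B "t # D"] walks(2) False W by simp
      next
        case True
        \<comment> \<open>the two steps along \<open>e\<close> cancel\<close>
        have "walk_sign \<Upsilon> (A @ D) = -1"
          using less.prems(3) esign_cases[OF assms(1) s2(2)] unfolding W by (auto simp: True st)
        moreover have "length (A @ D) < length W" "walk_edges (A @ D) \<subseteq> F"
          using W less.prems(2) by auto
        moreover have "walk \<Upsilon> u (A @ D) u" using walks walk_appendI[OF g] by blast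
        ultimately show ?thesis using less.hyps by blast
      qed
    qed
  qed
qed

text \<open>
  Replace the stretch of \<open>Q\<close> between its first and last vertex on the negative cycle \<open>W\<close> by one of
  the two arcs of \<open>W\<close>, which have opposite signs.
\<close>

lemma path_of_either_sign:
  assumes ori: "oriented_signed_graph S" and Q: "path S x Q y"
    and W: "cycle S z W" "walk_sign S W = -1"
    and pq: "p \<noteq> q" "{p, q} \<subseteq> set (walk_verts S x Q) \<inter> verts_of S (walk_edges W)"
    and sg: "sg = 1 \<or> sg = -1"
  obtains R where "path S x R y" "walk_edges R \<subseteq> walk_edges Q \<union> walk_edges W" "walk_sign S R = sg"
proof -
  note g = oriented_graph[OF ori] and found = that
  define X where "X = verts_of S (walk_edges W)"
  have wQ: "walk S x Q y" and dQ: "distinct (walk_verts S x Q)" using Q by (auto simp: path_def)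
  obtain Q1 Q' a where Q': "Q = Q1 @ Q'" "walk S x Q1 a" "walk S a Q' y"
    "set (walk_verts S x Q1) \<inter> X = {a}"
    using walk_first_in[OF g wQ, of X] pq(2) unfolding X_def by blast
  then have "a \<in> set (walk_verts S a Q') \<inter> X" by auto
  then have "set (walk_verts S a Q') \<inter> X \<noteq> {}" by blast
  then obtain Q2 Q3 b where Q3: "Q' = Q2 @ Q3" "walk S a Q2 b" "walk S b Q3 y"
    "set (walk_verts S b Q3) \<inter> X = {b}"
    using walk_last_in[OF g Q'(3)] by blast
  have verts_Q: "walk_verts S x Q = walk_verts S x Q1 @ map (step_head S) Q2 @ map (step_head S) Q3"
    unfolding Q' Q3 by simp
  have a: "a \<in> set (walk_verts S x Q1)" using Q'(2) end_in_walk_verts by metis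
  \<comment> \<open>If Q entered and left the cycle at the same vertex, the stretch between would be
    a closed path, hence empty, and Q could not meet the cycle in both p and q.\<close>
  have "a \<noteq> b"
  proof
    assume "a = b"
    have "path S a Q2 a"
      using Q3(2) \<open>a = b\<close> dQ a unfolding verts_Q path_def by (auto simp: walk_verts_def)
    then have "Q2 = []" by (rule path_closed_Nil)
    then have "set (walk_verts S x Q) \<inter> X \<subseteq> {a}"
      using Q'(4) Q3(4) \<open>a = b\<close> unfolding verts_Q by (auto simp: walk_verts_def)
    then show False using pq unfolding X_def by blast
  qed
  then have b: "b \<in> set (map (step_head S) Q2)"
    using end_in_walk_verts[OF Q3(2)] by (simp add: walk_verts_def)
  have Q1: "path S x Q1 a" using Q'(2) dQ unfolding verts_Q path_def by simp
  have Q3p: "path S b Q3 y" using Q3(3) dQ b unfolding verts_Q path_def by (auto simp: walk_verts_def)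
  have disj: "set (walk_verts S x Q1) \<inter> set (walk_verts S b Q3) = {}"
    using dQ b unfolding verts_Q by (auto simp: walk_verts_def)
  have "a \<in> X" "b \<in> X" using Q'(4) Q3(4) by auto
  then obtain W' where W': "cycle S a W'" "set W' = set W"
    using cycle_rotate[OF g W(1)] verts_of_cycle(2)[OF W(1)] unfolding X_def by blast
  then have edges: "walk_edges W' = walk_edges W" by (simp add: walk_edges_def)
  then have sgn: "walk_sign S W' = -1"
    using walk_sign_distinct W'(1) W unfolding cycle_def by metis
  have X: "X = set (walk_verts S a W')" "X = set (map (step_head S) W')"
    using verts_of_cycle[OF W'(1)] edges unfolding X_def by auto
  obtain A B where AB: "W' = A @ B" "walk S a A b" "walk S b B a"
    using walk_split_at[OF g, of a W' a b] W'(1) \<open>b \<in> X\<close> X(1) unfolding cycle_def by blast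
  have dAB: "distinct (map (step_head S) (A @ B))" using W'(1) AB(1) by (simp add: cycle_def)
  have "a \<in> set (map (step_head S) B)" "b \<in> set (map (step_head S) A)"
    using end_in_walk_verts[OF AB(2)] end_in_walk_verts[OF AB(3)] \<open>a \<noteq> b\<close>
    by (auto simp: walk_verts_def)
  then have A: "path S a A b" and B: "path S b B a"
    using AB dAB by (auto simp: path_def walk_verts_def)
  have arcs: "set (walk_verts S a A) \<subseteq> X" "set (walk_verts S a (rev_walk B)) \<subseteq> X"
    using walk_verts_rev[OF AB(3)] \<open>b \<in> X\<close> X(2) unfolding AB(1)
    by (auto simp: X(1) AB(1)) (auto simp: walk_verts_def)
  have signs: "walk_sign S A * walk_sign S B = -1" using sgn AB(1) by simp
  \<comment> \<open>Any arc N can replace the middle stretch: Q1 meets the cycle only in a, Q3 only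
    in b, and Q1 and Q3 are disjoint, so the concatenation is again a path.\<close>
  have result: thesis if N: "path S a N b" "set (walk_verts S a N) \<subseteq> X" "walk_edges N \<subseteq> walk_edges W"
    and sign: "walk_sign S Q1 * walk_sign S N * walk_sign S Q3 = sg" for N
  proof -
    have Q1N: "path S x (Q1 @ N) b"
      using N(2) Q'(4) by (intro path_append[OF g Q1 N(1)]) blast
    have "set (walk_verts S x (Q1 @ N)) \<subseteq> set (walk_verts S x Q1) \<union> X"
      using N(2) unfolding walk_verts_simps by (auto simp: walk_verts_def)
    then have "set (walk_verts S x (Q1 @ N)) \<inter> set (walk_verts S b Q3) \<subseteq> {b}"
      using Q3(4) disj by blast
    then have "path S x ((Q1 @ N) @ Q3) y" by (rule path_append[OF g Q1N Q3p])
    moreover have "walk_edges ((Q1 @ N) @ Q3) \<subseteq> walk_edges Q \<union> walk_edges W"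
      using N(3) by (simp add: Q'(1) Q3(1) le_supI2 le_supI1)
    moreover have "walk_sign S ((Q1 @ N) @ Q3) = sg" using sign by (simp add: mult.assoc)
    ultimately show thesis by (rule found)
  qed
  show thesis
  proof (cases "walk_sign S Q1 * walk_sign S A * walk_sign S Q3 = sg")
    case True
    then show ?thesis using result[OF A arcs(1)] edges AB(1) by auto
  next
    case False
    then have "walk_sign S Q1 * walk_sign S (rev_walk B) * walk_sign S Q3 = sg"
      using signs sg walk_sign_cases[OF ori Q'(2)] walk_sign_cases[OF ori Q3(3)]
        walk_sign_cases[OF ori AB(2)] by auto
    then show ?thesis using result[OF path_rev[OF g B] arcs(2)] edges AB(1) by auto
  qed
qed


section \<open>Extending a gain switcher by one edge\<close>

text \<open>Two F-walks from x to v of different signs would form a negative closed walk at v and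
  pin v. At the two ends of a link or loop in F the values of \<delta> differ by the factor
  \<open>esign\<close>, which is exactly what cancels in the switched gain. A half edge of F linked
  to v would itself pin v, so \<delta> vanishes at its end.\<close>

lemma unpinned_shift:
  fixes \<Upsilon> :: "('v, 'e, 'k::field) gain_signed_graph"
  assumes ori: "oriented_signed_graph \<Upsilon>" and "F \<subseteq> edges \<Upsilon>"
    and v: "v \<in> verts \<Upsilon>" "\<not> pinned \<Upsilon> F v"
  obtains \<delta> :: "'v \<Rightarrow> 'k" where "\<delta> v = 1"
    "\<And>x W. walk \<Upsilon> x W v \<Longrightarrow> walk_edges W \<subseteq> F \<Longrightarrow> \<delta> x = of_int (walk_sign \<Upsilon> W)"
    "\<And>x. \<not> linked \<Upsilon> F x v \<Longrightarrow> \<delta> x = 0"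
    "\<And>\<theta> t f. f \<in> F \<Longrightarrow> switched_gain \<Upsilon> (\<lambda>x. \<theta> x + t * \<delta> x) f = switched_gain \<Upsilon> \<theta> f"
proof -
  note g = oriented_graph[OF ori]
  have unique: "walk_sign \<Upsilon> W = walk_sign \<Upsilon> W'"
    if W: "walk \<Upsilon> x W v" "walk_edges W \<subseteq> F" and W': "walk \<Upsilon> x W' v" "walk_edges W' \<subseteq> F" for x W W'
  proof (rule ccontr)
    assume "walk_sign \<Upsilon> W \<noteq> walk_sign \<Upsilon> W'"
    then have "walk_sign \<Upsilon> (rev_walk W @ W') = -1"
      using walk_sign_cases[OF ori W(1)] walk_sign_cases[OF ori W'(1)] by auto
    moreover have "walk \<Upsilon> v (rev_walk W @ W') v"
      using walk_appendI[OF g walk_rev[OF g W(1)] W'(1)] .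
    ultimately have "pinned \<Upsilon> F v"
      using negative_closed_walk_pinned[OF ori] W(2) W'(2) by simp
    then show False using v(2) by simp
  qed
  \<comment> \<open>The default 0 solves the same equations on the vertices not linked to v, and it
    lets a nonzero value of \<delta> be read as a proof of linkage.\<close>
  define \<delta> :: "'v \<Rightarrow> 'k" where "\<delta> x = (if linked \<Upsilon> F x v
    then of_int (walk_sign \<Upsilon> (SOME W. walk \<Upsilon> x W v \<and> walk_edges W \<subseteq> F)) else 0)" for x
  have \<delta>_walk: "\<delta> x = of_int (walk_sign \<Upsilon> W)" if "walk \<Upsilon> x W v" "walk_edges W \<subseteq> F" for x W
  proof -
    have "walk \<Upsilon> x (SOME W. walk \<Upsilon> x W v \<and> walk_edges W \<subseteq> F) v \<and>
        walk_edges (SOME W. walk \<Upsilon> x W v \<and> walk_edges W \<subseteq> F) \<subseteq> F"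
      using that by (rule someI[where P = "\<lambda>W. walk \<Upsilon> x W v \<and> walk_edges W \<subseteq> F", OF conjI])
    then show ?thesis using unique that linkedI[OF that] unfolding \<delta>_def by metis
  qed
  have \<delta>_unlinked: "\<delta> x = 0" if "\<not> linked \<Upsilon> F x v" for x
    using that by (simp add: \<delta>_def)
  have \<delta>_step: "\<delta> (step_tail \<Upsilon> s) = of_int (esign \<Upsilon> (fst s)) * \<delta> (step_head \<Upsilon> s)"
    if s: "ordinary_edge \<Upsilon> (fst s)" "snd s < 2" "fst s \<in> F" for s
  proof (cases "linked \<Upsilon> F (step_head \<Upsilon> s) v")
    case True
    then obtain W where W: "walk \<Upsilon> (step_head \<Upsilon> s) W v" "walk_edges W \<subseteq> F"
      by (auto simp: linked_def)
    then have "walk \<Upsilon> (step_tail \<Upsilon> s) (s # W) v" "walk_edges (s # W) \<subseteq> F" using s by auto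
    from \<delta>_walk[OF this] \<delta>_walk[OF W] show ?thesis by simp
  next
    case False
    have "linked \<Upsilon> F (step_tail \<Upsilon> s) (step_head \<Upsilon> s)"
      using s step_ends_in_verts[OF g s(1,2)] by (intro linkedI[of _ _ "[s]"]) auto
    then have "\<not> linked \<Upsilon> F (step_tail \<Upsilon> s) v"
      using False linked_trans[OF g] linked_sym[OF g] by metis
    with False show ?thesis by (simp add: \<delta>_unlinked)
  qed
  have \<delta>_half: "\<delta> u = 0" if h: "half_edge \<Upsilon> h" "ends \<Upsilon> h = [u]" "h \<in> F" for h u
  proof (rule \<delta>_unlinked)
    have "figure_weight \<Upsilon> {h} u (- 2 * (of_int (orient \<Upsilon> h 0) * gain \<Upsilon> h))"
      using h unfolding figure_weight_def by blast
    then have "linked \<Upsilon> F v u \<Longrightarrow> pinned \<Upsilon> F v" using h(3) unfolding pinned_def by blast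
    then show "\<not> linked \<Upsilon> F u v" using v(2) linked_sym[OF g] by blast
  qed
  have "switched_gain \<Upsilon> (\<lambda>x. \<theta> x + t * \<delta> x) f = switched_gain \<Upsilon> \<theta> f" if f: "f \<in> F" for \<theta> t f
  proof -
    have "f \<in> edges \<Upsilon>" using f \<open>F \<subseteq> edges \<Upsilon>\<close> by blast
    then consider "loose_edge \<Upsilon> f" | "half_edge \<Upsilon> f" | "ordinary_edge \<Upsilon> f"
      using edge_kind_cases[OF g] by blast
    then show ?thesis
    proof cases
      case 1
      then show ?thesis by (simp add: switched_gain_def loose_edge_def)
    next
      case 2
      then obtain u where u: "ends \<Upsilon> f = [u]" by (rule half_edge_ends)
      then show ?thesis using \<delta>_half[OF 2 u f] by (simp add: switched_gain_def)
    next
      case 3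
      define s where "s = (f, 0::nat)"
      have s: "ordinary_edge \<Upsilon> (fst s)" "snd s < 2" "fst s \<in> F" using 3 f by (auto simp: s_def)
      have sw: "switched_gain \<Upsilon> \<eta> f = of_int (orient \<Upsilon> f 0) *
          (\<eta> (step_tail \<Upsilon> s) - of_int (esign \<Upsilon> f) * \<eta> (step_head \<Upsilon> s)) + gain \<Upsilon> f" for \<eta>
        using switched_gain_step[OF s(1,2), of \<eta>] orient_flip(1)[OF ori 3, of 0]
        by (simp add: s_def algebra_simps)
      have "\<delta> (step_tail \<Upsilon> s) = of_int (esign \<Upsilon> f) * \<delta> (step_head \<Upsilon> s)"
        using \<delta>_step[OF s] by (simp add: s_def)
      then show ?thesis unfolding sw by (simp add: algebra_simps)
    qed
  qed
  moreover have "\<delta> v = 1" using \<delta>_walk[of v "[]"] v(1) by simp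
  ultimately show thesis by (intro that[of \<delta>] \<delta>_walk \<delta>_unlinked)
qed

text \<open>The state of the induction when \<theta> settles F but not the next edge e. If the
  residual of e were 0, \<theta> itself would serve; assuming it nonzero turns every sign circuit
  through e inside \<open>insert e F\<close> into a contradiction.\<close>

locale gain_switcher_step =
  fixes \<Upsilon> :: "('v, 'e, 'k::field) gain_signed_graph" and F e and \<theta> :: "'v \<Rightarrow> 'k"
  assumes two: "(2::'k) \<noteq> 0" and ori: "oriented_signed_graph \<Upsilon>" and hyp: "hyperbalanced \<Upsilon>"
    and F: "F \<subseteq> edges \<Upsilon>" and e: "e \<in> edges \<Upsilon>" "e \<notin> F"
    and pot: "\<forall>f\<in>F. switched_gain \<Upsilon> \<theta> f = 0" and res: "switched_gain \<Upsilon> \<theta> e \<noteq> 0"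
begin

section \<open>Configurations excluded by a nonzero residual\<close>

lemmas gr = oriented_graph[OF ori]

text \<open>As edges are distinct, e is traversed exactly once, so its residual enters with a
  coefficient 1 or -1 and nothing can cancel it.\<close>

lemma walk_gain_through:
  assumes W: "walk \<Upsilon> u W v" "distinct (map fst W)" "walk_edges W \<subseteq> insert e F" "e \<in> walk_edges W"
  shows "walk_gain \<Upsilon> W \<noteq> \<theta> u - of_int (walk_sign \<Upsilon> W) * \<theta> v"
proof -
  obtain A s B where AB: "W = A @ s # B" "fst s = e"
    using W(4) by (auto simp: walk_edges_def dest: split_list)
  then have "e \<notin> walk_edges A" "e \<notin> walk_edges B"
    using W(2) by (auto simp: walk_edges_def)
  then have sub: "walk_edges A \<subseteq> F" "walk_edges B \<subseteq> F" using W(3) AB(1) by auto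
  have walks: "walk \<Upsilon> u A (step_tail \<Upsilon> s)" "walk \<Upsilon> (step_head \<Upsilon> s) B v"
    and s: "ordinary_edge \<Upsilon> (fst s)" "snd s < 2"
    using W(1) unfolding AB(1) by (auto simp: walk_append[OF gr])
  define t :: 'k where "t = of_int (walk_sign \<Upsilon> A) * of_int (orient \<Upsilon> (fst s) (snd s))"
  have "t \<noteq> 0"
    using walk_sign_cases[OF ori walks(1)] orient_flip(2)[OF ori s]
    unfolding t_def square_eq_1_iff by auto
  have "walk_gain \<Upsilon> W =
      \<theta> u - of_int (walk_sign \<Upsilon> W) * \<theta> v - t * switched_gain \<Upsilon> \<theta> e"
    unfolding AB(1) walk_gain_append walk_gain_Cons step_gain[OF ori s, of \<theta>]
      walk_gain_potential[OF ori pot walks(1) sub(1)] walk_gain_potential[OF ori pot walks(2) sub(2)]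
    by (simp add: t_def AB(2) algebra_simps)
  then show ?thesis using \<open>t \<noteq> 0\<close> res by simp
qed

text \<open>For e a half edge the residual enters the weight with the factor 2 or -2, which is
  nonzero by \<open>two\<close>.\<close>

lemma figure_weight_through:
  assumes "figure_weight \<Upsilon> C u k" "C \<subseteq> insert e F" "e \<in> C"
  shows "k \<noteq> 2 * \<theta> u"
  using assms(1)
proof (cases rule: figure_weight_cases)
  case (half h)
  then have "h = e" using assms(3) by simp
  then show ?thesis
    using half_edge_gain(1)[OF ori half(1,3), of \<theta>] half_edge_gain(2)[OF ori half(1,3)] half(4) res two
    by auto
next
  case (cycle W)
  then show ?thesis
    using walk_gain_through[of u W u] assms(2,3) by (simp add: cycle_def)
qed

text \<open>Since P and \<open>C\<^sub>2\<close> lie in F, the weight equation forces the weight of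
  \<open>C\<^sub>1\<close> to be the one that its potential predicts, although
  \<open>C\<^sub>1\<close> contains e.\<close>

lemma no_circuit_through_figure:
  assumes C1: "figure_weight \<Upsilon> C\<^sub>1 a k" "C\<^sub>1 \<subseteq> insert e F" "e \<in> C\<^sub>1"
    and C2: "figure_weight \<Upsilon> C\<^sub>2 b l" "C\<^sub>2 \<subseteq> F"
    and "linked \<Upsilon> F a b" and meet: "verts_of \<Upsilon> C\<^sub>1 \<inter> verts_of \<Upsilon> C\<^sub>2 \<subseteq> {z}"
  shows False
proof -
  have ne: "C\<^sub>1 \<noteq> C\<^sub>2" using C1(3) C2(2) e(2) by blast
  obtain W where W: "walk \<Upsilon> a W b" "walk_edges W \<subseteq> F"
    using \<open>linked \<Upsilon> F a b\<close> by (auto simp: linked_def)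
  obtain u P v k\<^sub>1 k\<^sub>2 where P: "figure_weight \<Upsilon> C\<^sub>1 u k\<^sub>1" "figure_weight \<Upsilon> C\<^sub>2 v k\<^sub>2"
    "path \<Upsilon> u P v" "walk_edges P \<subseteq> walk_edges W"
    "k\<^sub>1 = 2 * walk_gain \<Upsilon> P + of_int (walk_sign \<Upsilon> P) * k\<^sub>2"
    using linked_figures[OF ori hyp C1(1) C2(1) ne W(1) meet] .
  have "walk_gain \<Upsilon> P = \<theta> u - of_int (walk_sign \<Upsilon> P) * \<theta> v"
    using walk_gain_potential[OF ori pot, of u P v] P(3,4) W(2) by (auto simp: path_def)
  moreover have "k\<^sub>2 = 2 * \<theta> v" using figure_weight_potential[OF ori pot P(2) C2(2)] .
  ultimately have "k\<^sub>1 = 2 * \<theta> u" using P(5) by (simp add: right_diff_distrib)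
  then show False using figure_weight_through[OF P(1) C1(2,3)] by simp
qed

text \<open>The figures lie in different components of F, so the connecting path must use e. Their
  weights are those predicted by \<theta>; after cancelling 2 the weight equation predicts the gain
  of the path as well, against \<open>walk_gain_through\<close>.\<close>

lemma no_circuit_through_path:
  assumes C1: "figure_weight \<Upsilon> C\<^sub>1 a k" "C\<^sub>1 \<subseteq> F" and C2: "figure_weight \<Upsilon> C\<^sub>2 b l" "C\<^sub>2 \<subseteq> F"
    and "linked \<Upsilon> (insert e F) a b" and unlinked: "\<not> linked \<Upsilon> F a b"
  shows False
proof -
  have move: "linked \<Upsilon> F c x" if "figure_weight \<Upsilon> C c m" "C \<subseteq> F" "x \<in> verts_of \<Upsilon> C" for C c m x
    using figure_weight_move[OF ori that(1,3)] that(2) by (metis linkedI subset_trans)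
  have disj: "\<not> linked \<Upsilon> F x y" if "x \<in> verts_of \<Upsilon> C\<^sub>1" "y \<in> verts_of \<Upsilon> C\<^sub>2" for x y
    using move[OF C1 that(1)] move[OF C2 that(2)] unlinked linked_trans[OF gr] linked_sym[OF gr] by metis
  \<comment> \<open>The figures are in fact disjoint, as a common vertex would link them within
    F.\<close>
  have "verts_of \<Upsilon> C\<^sub>1 \<inter> verts_of \<Upsilon> C\<^sub>2 \<subseteq> {a}"
  proof
    fix x assume "x \<in> verts_of \<Upsilon> C\<^sub>1 \<inter> verts_of \<Upsilon> C\<^sub>2"
    then have x: "x \<in> verts_of \<Upsilon> C\<^sub>1" "x \<in> verts_of \<Upsilon> C\<^sub>2" by auto
    have "linked \<Upsilon> F x x"
      using move[OF C1 x(1)] linked_trans[OF gr] linked_sym[OF gr] by metis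
    then show "x \<in> {a}" using disj[OF x] by simp
  qed
  moreover have "C\<^sub>1 \<noteq> C\<^sub>2"
  proof
    assume "C\<^sub>1 = C\<^sub>2"
    then have "b \<in> verts_of \<Upsilon> C\<^sub>1" using figure_weight_negative_figure(2)[OF ori C2(1)] by simp
    then show False using move[OF C1] unlinked by blast
  qed
  moreover obtain W where W: "walk \<Upsilon> a W b" "walk_edges W \<subseteq> insert e F"
    using \<open>linked \<Upsilon> (insert e F) a b\<close> by (auto simp: linked_def)
  ultimately obtain u P v k\<^sub>1 k\<^sub>2 where P: "figure_weight \<Upsilon> C\<^sub>1 u k\<^sub>1" "figure_weight \<Upsilon> C\<^sub>2 v k\<^sub>2"
    "path \<Upsilon> u P v" "walk_edges P \<subseteq> walk_edges W"
    "k\<^sub>1 = 2 * walk_gain \<Upsilon> P + of_int (walk_sign \<Upsilon> P) * k\<^sub>2"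
    using linked_figures[OF ori hyp C1(1) C2(1)] by metis
  have walk_P: "walk \<Upsilon> u P v" using P(3) by (simp add: path_def)
  have "\<not> linked \<Upsilon> F u v"
    using disj figure_weight_negative_figure(2)[OF ori P(1)] figure_weight_negative_figure(2)[OF ori P(2)] .
  then have "e \<in> walk_edges P" using linkedI[OF walk_P, of F] P(4) W(2) by blast
  then have "walk_gain \<Upsilon> P \<noteq> \<theta> u - of_int (walk_sign \<Upsilon> P) * \<theta> v"
    using walk_gain_through[OF walk_P path_distinct_edges[OF P(3)]] P(4) W(2) by auto
  moreover have "k\<^sub>1 = 2 * \<theta> u" "k\<^sub>2 = 2 * \<theta> v"
    using figure_weight_potential[OF ori pot P(1) C1(2)] figure_weight_potential[OF ori pot P(2) C2(2)] .
  then have "2 * walk_gain \<Upsilon> P = 2 * (\<theta> u - of_int (walk_sign \<Upsilon> P) * \<theta> v)"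
    using P(5) by (simp add: algebra_simps)
  then have "walk_gain \<Upsilon> P = \<theta> u - of_int (walk_sign \<Upsilon> P) * \<theta> v"
    using two by (simp only: mult_cancel_left) simp
  ultimately show False by simp
qed

text \<open>On a positive closed walk the potential terms cancel, so the residual alone would make
  the gain of the resulting circle nonzero.\<close>

lemma no_positive_closing_path:
  assumes s: "ordinary_edge \<Upsilon> e" "fst s = e" "snd s < 2"
    and R: "path \<Upsilon> (step_head \<Upsilon> s) R (step_tail \<Upsilon> s)" "walk_edges R \<subseteq> F"
  shows "walk_sign \<Upsilon> R \<noteq> esign \<Upsilon> e"
proof
  assume "walk_sign \<Upsilon> R = esign \<Upsilon> e"
  then have pos: "walk_sign \<Upsilon> (s # R) = 1" using esign_cases[OF ori s(1)] s(2) by auto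
  have c: "cycle \<Upsilon> (step_tail \<Upsilon> s) (s # R)"
    using cycle_of_path[OF gr] s R e(2) by blast
  then have "walk_gain \<Upsilon> (s # R) = 0" using hyperbalanced_positive_cycle[OF ori hyp] pos by blast
  moreover have "walk_gain \<Upsilon> (s # R) \<noteq> \<theta> (step_tail \<Upsilon> s) - of_int 1 * \<theta> (step_tail \<Upsilon> s)"
    using walk_gain_through[of _ "s # R"] c R(2) s(2) unfolding cycle_def pos[symmetric] by auto
  ultimately show False by simp
qed

section \<open>Killing the residual of the new edge\<close>

lemma extend_unpinned:
  assumes s: "ordinary_edge \<Upsilon> e" "fst s = e" "snd s < 2" and "\<not> pinned \<Upsilon> F (step_tail \<Upsilon> s)"
  shows "\<exists>\<theta>'. \<forall>f\<in>insert e F. switched_gain \<Upsilon> \<theta>' f = 0"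
proof -
  let ?v = "step_tail \<Upsilon> s" and ?w = "step_head \<Upsilon> s"
  have v: "?v \<in> verts \<Upsilon>" using step_ends_in_verts(1)[OF gr] s by simp
  obtain \<delta> :: "'v \<Rightarrow> 'k" where \<delta>: "\<delta> ?v = 1"
    "\<And>x W. walk \<Upsilon> x W ?v \<Longrightarrow> walk_edges W \<subseteq> F \<Longrightarrow> \<delta> x = of_int (walk_sign \<Upsilon> W)"
    "\<And>x. \<not> linked \<Upsilon> F x ?v \<Longrightarrow> \<delta> x = 0"
    "\<And>\<theta> t f. f \<in> F \<Longrightarrow> switched_gain \<Upsilon> (\<lambda>x. \<theta> x + t * \<delta> x) f = switched_gain \<Upsilon> \<theta> f"
    using unpinned_shift[OF ori F v assms(4)] by blast
  define \<tau> :: 'k where "\<tau> = of_int (orient \<Upsilon> e (snd s))"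
  \<comment> \<open>The rate at which adding multiples of \<delta> changes the switched gain of e,
    with \<delta> equal to 1 at the tail. For a negative loop it is
    \<open>2 * \<tau>\<close>.\<close>
  define c where "c = \<tau> * (1 - of_int (esign \<Upsilon> e) * \<delta> ?w)"
  have "\<tau> * \<tau> = 1"
    using orient_flip(2)[OF ori s(1,3)] unfolding \<tau>_def by (metis of_int_mult of_int_1)
  then have "\<tau> \<noteq> 0" by auto
  have orient': "of_int (orient \<Upsilon> e (1 - snd s)) = - of_int (esign \<Upsilon> e) * \<tau>"
    using orient_flip(1)[OF ori s(1,3)] unfolding \<tau>_def by (simp only: of_int_mult of_int_minus)
  have shift: "switched_gain \<Upsilon> (\<lambda>x. \<theta> x + t * \<delta> x) e = switched_gain \<Upsilon> \<theta> e + t * c" for t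
    unfolding switched_gain_step[of \<Upsilon> s, unfolded s(2), OF s(1,3)] orient' \<delta>(1)
    by (simp add: c_def algebra_simps flip: \<tau>_def)
  have "c \<noteq> 0"
  proof
    assume "c = 0"
    then have 1: "of_int (esign \<Upsilon> e) * \<delta> ?w = 1" using \<open>\<tau> \<noteq> 0\<close> by (simp add: c_def)
    then have "linked \<Upsilon> F ?w ?v" using \<delta>(3)[of ?w] by (cases "linked \<Upsilon> F ?w ?v") auto
    then obtain W where W: "walk \<Upsilon> ?w W ?v" "walk_edges W \<subseteq> F" by (auto simp: linked_def)
    obtain R where R: "path \<Upsilon> ?w R ?v" "walk_edges R \<subseteq> walk_edges W"
      using walk_to_path[OF gr W(1)] .
    have walk_R: "walk \<Upsilon> ?w R ?v" "walk_edges R \<subseteq> F" using R W(2) by (auto simp: path_def)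
    \<comment> \<open>Only now can the integer sign of R be read off from \<delta>, a field element.
      The vanishing of c then says that R closes a positive circle with e.\<close>
    have "(- 1 :: 'k) \<noteq> 1" using two by (metis add.left_inverse one_add_one)
    then have "walk_sign \<Upsilon> R = esign \<Upsilon> e"
      using 1 \<delta>(2)[OF walk_R] walk_sign_cases[OF ori walk_R(1)] esign_cases[OF ori s(1)] by auto
    then show False using no_positive_closing_path[OF s R(1) walk_R(2)] by simp
  qed
  then have "switched_gain \<Upsilon> (\<lambda>x. \<theta> x + (- switched_gain \<Upsilon> \<theta> e / c) * \<delta> x) e = 0"
    unfolding shift by simp
  then have "\<forall>f\<in>insert e F. switched_gain \<Upsilon>
      (\<lambda>x. \<theta> x + (- switched_gain \<Upsilon> \<theta> e / c) * \<delta> x) f = 0"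
    using pot \<delta>(4)[of _ \<theta> "- switched_gain \<Upsilon> \<theta> e / c"] by simp
  then show ?thesis by (intro exI)
qed

text \<open>If F does not link the ends of e, their figures lie in different components of F and e
  lies on every connecting path. Otherwise e closes a circle with a path Q in F; this circle must be
  negative, and it is joined within F to the figure C that pins the tail.\<close>

lemma not_both_ends_pinned:
  assumes s: "ordinary_edge \<Upsilon> e" "fst s = e" "snd s < 2"
    and "pinned \<Upsilon> F (step_tail \<Upsilon> s)" "pinned \<Upsilon> F (step_head \<Upsilon> s)"
  shows False
proof -
  let ?v = "step_tail \<Upsilon> s" and ?w = "step_head \<Upsilon> s"
  obtain C x k where C: "figure_weight \<Upsilon> C x k" "C \<subseteq> F" "linked \<Upsilon> F ?v x"
    using assms(4) unfolding pinned_def by blast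
  obtain D y l where D: "figure_weight \<Upsilon> D y l" "D \<subseteq> F" "linked \<Upsilon> F ?w y"
    using assms(5) unfolding pinned_def by blast
  show False
  proof (cases "linked \<Upsilon> F ?w ?v")
    case False
    have "linked \<Upsilon> (insert e F) ?v ?w"
      using s step_ends_in_verts[OF gr, of s] by (intro linkedI[of _ _ "[s]"]) auto
    moreover have mono: "linked \<Upsilon> F a b \<Longrightarrow> linked \<Upsilon> (insert e F) a b" for a b
      unfolding linked_def by blast
    ultimately have "linked \<Upsilon> (insert e F) x y"
      using C(3) D(3) linked_trans[OF gr] linked_sym[OF gr] by metis
    moreover have "\<not> linked \<Upsilon> F x y"
      using False C(3) D(3) linked_trans[OF gr] linked_sym[OF gr] by metis
    ultimately show False using no_circuit_through_path[OF C(1,2) D(1,2)] by blast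
  next
    case True
    then obtain W where W: "walk \<Upsilon> ?w W ?v" "walk_edges W \<subseteq> F" by (auto simp: linked_def)
    obtain Q where Q: "path \<Upsilon> ?w Q ?v" "walk_edges Q \<subseteq> walk_edges W"
      using walk_to_path[OF gr W(1)] .
    have QF: "walk_edges Q \<subseteq> F" using Q(2) W(2) by simp
    have walk_Q: "walk \<Upsilon> ?w Q ?v" using Q(1) by (simp add: path_def)
    have cyc: "cycle \<Upsilon> ?v (s # Q)"
      using cycle_of_path[OF gr _ s(3) Q(1)] s QF e(2) by blast
    have "walk_sign \<Upsilon> Q \<noteq> esign \<Upsilon> e" using no_positive_closing_path[OF s Q(1) QF] .
    then have "walk_sign \<Upsilon> (s # Q) = -1"
      using esign_cases[OF ori s(1)] walk_sign_cases[OF ori walk_Q] s(2) by auto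
    then have fig: "figure_weight \<Upsilon> (insert e (walk_edges Q)) ?v (walk_gain \<Upsilon> (s # Q))"
      using cyc s(2) unfolding figure_weight_def by (metis walk_edges_simps(2))
    have verts: "verts_of \<Upsilon> (insert e (walk_edges Q)) = set (walk_verts \<Upsilon> ?w Q)"
      using verts_of_cycle(2)[OF cyc] s(2) by (simp add: walk_verts_def)
    \<comment> \<open>If \<open>C\<close> met the circle through \<open>e\<close> twice, rerouting \<open>Q\<close> along \<open>C\<close> would close a positive circle
      with \<open>e\<close>.\<close>
    have "\<not> (p \<noteq> q \<and> {p, q} \<subseteq> set (walk_verts \<Upsilon> ?w Q) \<inter> verts_of \<Upsilon> C)" for p q
    proof
      assume pq: "p \<noteq> q \<and> {p, q} \<subseteq> set (walk_verts \<Upsilon> ?w Q) \<inter> verts_of \<Upsilon> C"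
      show False
        using C(1)
      proof (cases rule: figure_weight_cases)
        case (half h)
        then show False using pq by (auto simp: verts_of_def)
      next
        case (cycle Z)
        obtain R where R: "path \<Upsilon> ?w R ?v" "walk_edges R \<subseteq> walk_edges Q \<union> walk_edges Z"
          "walk_sign \<Upsilon> R = esign \<Upsilon> e"
          using path_of_either_sign[OF ori Q(1) cycle(1,2), of p q "esign \<Upsilon> e"] pq cycle(3)
            esign_cases[OF ori s(1)] by blast
        then have "walk_edges R \<subseteq> F" using QF C(2) cycle(3) by blast
        then show False using no_positive_closing_path[OF s R(1)] R(3) by blast
      qed
    qed
    then obtain z where "verts_of \<Upsilon> (insert e (walk_edges Q)) \<inter> verts_of \<Upsilon> C \<subseteq> {z}"
      unfolding verts by blast
    then show False
      using no_circuit_through_figure[OF fig _ _ C(1,2,3)] QF by blast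
  qed
qed

text \<open>Here e is itself a negative figure with a single vertex, so a figure of F linked to v
  would form a handcuff with it. Hence v is not pinned, and as \<delta> is 1 at v, the residual is
  removed by dividing by the orientation sign.\<close>

lemma extend_half:
  assumes h: "half_edge \<Upsilon> e" "ends \<Upsilon> e = [v]"
  shows "\<exists>\<theta>'. \<forall>f\<in>insert e F. switched_gain \<Upsilon> \<theta>' f = 0"
proof -
  define k where "k = - 2 * (of_int (orient \<Upsilon> e 0) * gain \<Upsilon> e)"
  have fig: "figure_weight \<Upsilon> {e} v k" using h unfolding figure_weight_def k_def by blast
  have "\<not> pinned \<Upsilon> F v"
  proof
    assume "pinned \<Upsilon> F v"
    then obtain C x l where C: "figure_weight \<Upsilon> C x l" "C \<subseteq> F" "linked \<Upsilon> F v x"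
      unfolding pinned_def by blast
    have "verts_of \<Upsilon> {e} \<inter> verts_of \<Upsilon> C \<subseteq> {v}" using h(2) by (simp add: verts_of_def)
    then show False using no_circuit_through_figure[OF fig _ _ C] by blast
  qed
  then obtain \<delta> :: "'v \<Rightarrow> 'k" where \<delta>: "\<delta> v = 1"
    "\<And>\<theta> t f. f \<in> F \<Longrightarrow> switched_gain \<Upsilon> (\<lambda>x. \<theta> x + t * \<delta> x) f = switched_gain \<Upsilon> \<theta> f"
    using unpinned_shift[OF ori F figure_weight_negative_figure(3)[OF ori fig]] by metis
  define \<tau> :: 'k where "\<tau> = of_int (orient \<Upsilon> e 0)"
  have "\<tau> \<noteq> 0" using half_edge_gain(2)[OF ori h] by (auto simp: \<tau>_def)
  then have "switched_gain \<Upsilon> (\<lambda>x. \<theta> x + (- switched_gain \<Upsilon> \<theta> e / \<tau>) * \<delta> x) e = 0"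
    by (simp add: switched_gain_def h(2) \<delta>(1) field_simps flip: \<tau>_def)
  then have "\<forall>f\<in>insert e F. switched_gain \<Upsilon>
      (\<lambda>x. \<theta> x + (- switched_gain \<Upsilon> \<theta> e / \<tau>) * \<delta> x) f = 0"
    using pot \<delta>(2)[of _ \<theta> "- switched_gain \<Upsilon> \<theta> e / \<tau>"] by simp
  then show ?thesis by (intro exI)
qed

lemma extend: "\<exists>\<theta>'. \<forall>f\<in>insert e F. switched_gain \<Upsilon> \<theta>' f = 0"
proof -
  consider "loose_edge \<Upsilon> e" | "half_edge \<Upsilon> e" | "ordinary_edge \<Upsilon> e"
    using edge_kind_cases[OF gr e(1)] by blast
  then show ?thesis
  proof cases
    case 1
    then have "sign_circuit \<Upsilon> {e}" by (auto simp: sign_circuit_def)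
    moreover have "circuit_gain \<Upsilon> {e} (gain \<Upsilon> e)" using 1 by (rule circuit_gain.loose)
    ultimately have "gain \<Upsilon> e = 0"
      using hyp e(1) unfolding hyperbalanced_def neutral_circuit_def by blast
    then show ?thesis using 1 res by (simp add: switched_gain_def loose_edge_def)
  next
    case 2
    then show ?thesis using extend_half half_edge_ends by metis
  next
    case 3
    \<comment> \<open>Reading e from its other end makes its head the tail, so
      \<open>extend_unpinned\<close> applies to whichever end is not pinned.\<close>
    have "step_head \<Upsilon> (e, 0) = step_tail \<Upsilon> (e, 1)" by (simp add: step_head_def step_tail_def)
    then show ?thesis
      using not_both_ends_pinned[of "(e, 0)"] extend_unpinned[of "(e, 0)"]
        extend_unpinned[of "(e, 1)"] 3 by auto
  qed
qed

end

section \<open>Induction over the edge set and conclusion\<close>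

lemma hyperbalanced_imp_switching:
  fixes \<Upsilon> :: "('v, 'e, 'k::field) gain_signed_graph"
  assumes "(2::'k) \<noteq> 0" "oriented_signed_graph \<Upsilon>" "hyperbalanced \<Upsilon>"
  shows "\<exists>\<theta>. \<forall>e\<in>edges \<Upsilon>. switched_gain \<Upsilon> \<theta> e = 0"
proof -
  have "finite (edges \<Upsilon>)" using oriented_graph[OF assms(2)] by (simp add: graph_def)
  then show ?thesis
  proof (induction rule: finite_subset_induct'[OF _ subset_refl, consumes 1, case_names empty insert])
    case (insert e F)
    then obtain \<theta> where \<theta>: "\<forall>f\<in>F. switched_gain \<Upsilon> \<theta> f = 0" by blast
    show ?case
    proof (cases "switched_gain \<Upsilon> \<theta> e = 0")
      case True
      then show ?thesis using \<theta> by auto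
    next
      case False
      then interpret gain_switcher_step \<Upsilon> F e \<theta>
        using assms insert \<theta> by unfold_locales auto
      show ?thesis by (rule extend)
    qed
  qed simp
qed

theorem theorem2p13:
  fixes \<Upsilon> :: "('v, 'e, 'k::field) gain_signed_graph"
  assumes "CHAR('k) \<noteq> 2"
    and "gain_signed_graph \<Upsilon>"
  shows "hyperbalanced \<Upsilon> \<longleftrightarrow> (\<exists>\<theta> :: 'v \<Rightarrow> 'k. \<forall>e\<in>edges \<Upsilon>. switched_gain \<Upsilon> \<theta> e = 0)"
proof -
  \<comment> \<open>If 2 were 0, the characteristic would divide 2; with 2 excluded only 1 remains,
    which is impossible in a field.\<close>
  have "(2::'k) \<noteq> 0"
  proof
    assume "(2::'k) = 0"
    then have "of_nat 2 = (0::'k)" by simp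
    then have "CHAR('k) dvd 2" by (simp only: of_nat_eq_0_iff_char_dvd)
    moreover from this have "CHAR('k) \<le> 2" "CHAR('k) \<noteq> 0"
      by (simp_all add: dvd_imp_le) (metis dvd_0_left_iff zero_neq_numeral gr0I)
    moreover have "CHAR('k) \<noteq> 1" using CHAR_not_1 by auto
    ultimately show False using assms(1) by linarith
  qed
  then show ?thesis
    using hyperbalanced_imp_switching switching_imp_hyperbalanced assms(2) by blast
qed

end
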